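(* Let $\mathcal H$ be a Hilbert space, $\mathcal D\subset\mathcal G$ a nonempty subset of a normed space $\mathcal G$, and let $C(p)$, $p\in\mathcal D$, be given by $$C(p)=\{x\in\mathcal H \mid \langle x\mid g_i(p)\rangle=f_i(p),\ i\in I_1,\ \ \langle x\mid g_i(p)\rangle\le f_i(p),\ i\in I_2\},$$ where $f_i:\mathcal D\to\mathbb R$, $g_i:\mathcal D\to\mathcal H$, $i\in I_1\cup I_2\neq\emptyset$, are locally Lipschitz on $\mathcal D$. Let $\bar p\in\mathcal D$, $\bar v\notin C(\bar p)$ and $\bar x=P(\bar v,\bar p)$. Assume that there exists an equivalent representation $\mathcal R$ of $p\mapsto C(p)$ such that - RCRCQ holds for $\mathcal R$ at $(\bar p,\bar x)$; - $\mathcal R$ is a stable representation of $p\mapsto C(p)$ at $(\bar p,\bar v,\bar x)$ with some set $\bar K\subset I^{\mathcal R}_{\bar p}(\bar x)\cap\tilde I_2$. Then there exist neighbourhoods $W(\bar v)$ of $\bar v$ and $U(\bar p)$ of $\bar p$ and a constant $\ell^0>0$ such that $$\|(v_1-v_2)-2[P(v_1,p_1)-P(v_2,p_2)]\|\le\|v_1-v_2\|+\ell^0\|p_1-p_2\|$$ for all $(v_1,p_1),(v_2,p_2)\in W(\bar v)\times U(\bar p)$.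
   Context: $\mathcal H$ is a real Hilbert space with inner product $\langle\cdot\mid\cdot\rangle$. $\mathcal D$ carries the topology induced by the norm of $\mathcal G$; neighbourhoods of $\bar p$ are relative to $\mathcal D$. The index sets are $I_1=\emptyset$ or $I_1=\{1,\dots,q\}$, and $I_2=\emptyset$ or $I_2=\{q+1,\dots,m\}$. $P(v,p)$ denotes the projection of $v$ onto the closed convex set $C(p)$, defined whenever $C(p)\ne\emptyset$; an assertion involving $P(v,p)$ includes $C(p)\neq\emptyset$. Lower Kuratowski limit: for a multifunction $F:\mathcal D\rightrightarrows\mathcal H$, $\liminf_{p\to\bar p,\,p\in\mathcal D}F(p)$ is the set of $y\in\mathcal H$ such that for every sequence $p_k\to\bar p$, $p_k\in\mathcal D$, there exist $y_k\in F(p_k)$ with $y_k\to y$. Equivalent representation: a multifunction $\mathcal R:p\mapsto R(p)$ with $R(p)=C(p)$ for all $p\in\mathcal D$, where $R(p)$ is given (together with its describing data) as $R(p)=\{x\in\mathcal H\mid\langle x\mid\tilde g_i(p)\rangle=\tilde f_i(p),\ i\in\tilde I_1,\ \langle x\mid\tilde g_i(p)\rangle\le\tilde f_i(p),\ i\in\tilde I_2\}$, with $\tilde I_1,\tilde I_2$ disjoint index sets, $\tilde I_1\cup\tilde I_2$ finite and nonempty, and $\tilde f_i:\mathcal D\to\mathbb R$, $\tilde g_i:\mathcal D\to\mathcal H$ locally Lipschitz on $\mathcal D$. Put $I^{\mathcal R}_p(x)=\{i\in\tilde I_1\cup\tilde I_2\mid\langle x\mid\tilde g_i(p)\rangle=\tilde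 f_i(p)\}$. RCRCQ holds for $\mathcal R$ at $(\bar p,\bar x)$, $\bar x\in R(\bar p)$, if there is a neighbourhood $U(\bar p)$ such that for every $J$ with $\tilde I_1\subset J\subset I^{\mathcal R}_{\bar p}(\bar x)$ and every $p\in U(\bar p)$, $\mathrm{rank}\{\tilde g_i(p),i\in J\}=\mathrm{rank}\{\tilde g_i(\bar p),i\in J\}$. Stable representation: for $\bar p\in\mathcal D$, $\bar v\notin C(\bar p)$, $\bar x\in C(\bar p)$, an equivalent representation $\mathcal R$ is stable at $(\bar p,\bar v,\bar x)$ with the set $\bar K\subset I^{\mathcal R}_{\bar p}(\bar x)\cap\tilde I_2$ (possibly empty) if: (1) $\bar v-\bar x=\sum_{i\in\tilde I_1\cup\bar K}\bar\lambda_i\tilde g_i(\bar p)$ with $\bar\lambda_i>0$ for $i\in\bar K$ and $\tilde g_i(\bar p)$, $i\in\tilde I_1\cup\bar K$, linearly independent; and (2) for every (possibly empty) $L\subset(I^{\mathcal R}_{\bar p}(\bar x)\cap\tilde I_2)\setminus\bar K$ such that $\tilde g_i(\bar p)$, $i\in\tilde I_1\cup\bar K\cup L$, are linearly independent, $\bar x\in\liminf_{p\to\bar p,\,p\in\mathcal D}R_{\bar K,L}(p)$, where $R_{\bar K,L}(p)=\{x\in\mathcal H\mid\langle x\mid\tilde g_i(p)\rangle=\tilde f_i(p),\ i\in\tilde I_1\cup\bar K\cup L,\ \langle x\mid\tilde g_i(p)\rangle\le\tilde f_i(p),\ i\in\tilde I_2\setminus(\bar K\cup L)\}$. *)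

theory Defs
  imports "HOL-Analysis.Analysis"
begin

definition locally_lipschitz_on :: "'g::metric_space set \<Rightarrow> ('g \<Rightarrow> 'b::metric_space) \<Rightarrow> bool" where
  "locally_lipschitz_on D f \<longleftrightarrow>
     (\<forall>p\<in>D. \<exists>u>0. \<exists>L. L-lipschitz_on (cball p u \<inter> D) f)"

text \<open>The library constant closest_point is restricted to spaces with the Heine-Borel property,
  which excludes infinite-dimensional Hilbert spaces. The value is meaningful only for nonempty
  (closed convex) sets, so statements about it must also assert nonemptiness.\<close>

definition metric_projection :: "'h::real_inner set \<Rightarrow> 'h \<Rightarrow> 'h" where
  "metric_projection S v = (THE x. x \<in> S \<and> (\<forall>y\<in>S. dist v x \<le> dist v y))"

definition polyhedral_set ::
  "'i set \<Rightarrow> 'i set \<Rightarrow> ('i \<Rightarrow> 'g \<Rightarrow> real) \<Rightarrow> ('i \<Rightarrow> 'g \<Rightarrow> 'h::real_inner) \<Rightarrow> 'g \<Rightarrow> 'h set" where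
  "polyhedral_set I\<^sub>1 I\<^sub>2 f g p =
     {x. (\<forall>i\<in>I\<^sub>1. x \<bullet> g i p = f i p) \<and> (\<forall>i\<in>I\<^sub>2. x \<bullet> g i p \<le> f i p)}"

definition active_set ::
  "'i set \<Rightarrow> 'i set \<Rightarrow> ('i \<Rightarrow> 'g \<Rightarrow> real) \<Rightarrow> ('i \<Rightarrow> 'g \<Rightarrow> 'h::real_inner) \<Rightarrow> 'g \<Rightarrow> 'h \<Rightarrow> 'i set" where
  "active_set I\<^sub>1 I\<^sub>2 f g p x = {i \<in> I\<^sub>1 \<union> I\<^sub>2. x \<bullet> g i p = f i p}"

text \<open>Linear independence of a family: a family with a repeated vector is dependent, although
  its range may be an independent set.\<close>

definition independent_family :: "'i set \<Rightarrow> ('i \<Rightarrow> 'h::real_vector) \<Rightarrow> bool" where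
  "independent_family J a \<longleftrightarrow> inj_on a J \<and> independent (a ` J)"

text \<open>Lower Kuratowski limit relative to D. The points of the approximating sequence are required
  for all indices, not only for almost all; hence a nonempty limit forces F to be nonempty-valued
  on all of D.\<close>

definition lower_limit ::
  "'g::topological_space set \<Rightarrow> ('g \<Rightarrow> 'h::topological_space set) \<Rightarrow> 'g \<Rightarrow> 'h set" where
  "lower_limit D F pbar =
     {y. \<forall>pk. (\<forall>k::nat. pk k \<in> D) \<longrightarrow> pk \<longlonglongrightarrow> pbar \<longrightarrow>
           (\<exists>yk. (\<forall>k. yk k \<in> F (pk k)) \<and> yk \<longlonglongrightarrow> y)}"

definition equivalent_representation ::
  "'g::metric_space set \<Rightarrow> ('g \<Rightarrow> 'h::real_inner set) \<Rightarrow>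
   'i set \<Rightarrow> 'i set \<Rightarrow> ('i \<Rightarrow> 'g \<Rightarrow> real) \<Rightarrow> ('i \<Rightarrow> 'g \<Rightarrow> 'h) \<Rightarrow> bool" where
  "equivalent_representation D C I\<^sub>1 I\<^sub>2 f g \<longleftrightarrow>
     I\<^sub>1 \<inter> I\<^sub>2 = {} \<and> finite (I\<^sub>1 \<union> I\<^sub>2) \<and> I\<^sub>1 \<union> I\<^sub>2 \<noteq> {} \<and>
     (\<forall>i \<in> I\<^sub>1 \<union> I\<^sub>2. locally_lipschitz_on D (f i) \<and> locally_lipschitz_on D (g i)) \<and>
     (\<forall>p\<in>D. polyhedral_set I\<^sub>1 I\<^sub>2 f g p = C p)"

definition RCRCQ ::
  "'g::topological_space set \<Rightarrow> 'i set \<Rightarrow> 'i set \<Rightarrow>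
   ('i \<Rightarrow> 'g \<Rightarrow> real) \<Rightarrow> ('i \<Rightarrow> 'g \<Rightarrow> 'h::real_inner) \<Rightarrow> 'g \<Rightarrow> 'h \<Rightarrow> bool" where
  "RCRCQ D I\<^sub>1 I\<^sub>2 f g pbar xbar \<longleftrightarrow>
     (\<exists>U. openin (top_of_set D) U \<and> pbar \<in> U \<and>
        (\<forall>J. I\<^sub>1 \<subseteq> J \<and> J \<subseteq> active_set I\<^sub>1 I\<^sub>2 f g pbar xbar \<longrightarrow>
           (\<forall>p\<in>U. dim ((\<lambda>i. g i p) ` J) = dim ((\<lambda>i. g i pbar) ` J))))"

definition stable_representation ::
  "'g::metric_space set \<Rightarrow> ('g \<Rightarrow> 'h::real_inner set) \<Rightarrow>
   'i set \<Rightarrow> 'i set \<Rightarrow> ('i \<Rightarrow> 'g \<Rightarrow> real) \<Rightarrow> ('i \<Rightarrow> 'g \<Rightarrow> 'h) \<Rightarrow>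
   'g \<Rightarrow> 'h \<Rightarrow> 'h \<Rightarrow> 'i set \<Rightarrow> bool" where
  "stable_representation D C I\<^sub>1 I\<^sub>2 f g pbar vbar xbar K \<longleftrightarrow>
     equivalent_representation D C I\<^sub>1 I\<^sub>2 f g \<and>
     K \<subseteq> active_set I\<^sub>1 I\<^sub>2 f g pbar xbar \<inter> I\<^sub>2 \<and>
     (\<exists>lam::'i \<Rightarrow> real. vbar - xbar = (\<Sum>i \<in> I\<^sub>1 \<union> K. lam i *\<^sub>R g i pbar) \<and> (\<forall>i\<in>K. lam i > 0)) \<and>
     independent_family (I\<^sub>1 \<union> K) (\<lambda>i. g i pbar) \<and>
     (\<forall>L. L \<subseteq> (active_set I\<^sub>1 I\<^sub>2 f g pbar xbar \<inter> I\<^sub>2) - K \<and>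
          independent_family (I\<^sub>1 \<union> K \<union> L) (\<lambda>i. g i pbar) \<longrightarrow>
          xbar \<in> lower_limit D (polyhedral_set (I\<^sub>1 \<union> K \<union> L) (I\<^sub>2 - (K \<union> L)) f g) pbar)"

end

theory Submission
  imports Defs
begin

text \<open>For a fixed parameter the projection \<open>P\<close> onto a closed convex set is firmly nonexpansive, so
  \<open>v \<mapsto> v - 2 P v\<close> is nonexpansive. Splitting the left-hand side of the claim at
  \<open>P(v\<^sub>2, p\<^sub>1)\<close> therefore leaves one thing to prove: near \<open>(vbar, pbar)\<close> the projection is
  Lipschitz in \<open>p\<close>, uniformly in \<open>v\<close>. The set \<open>D\<close> is arbitrary, so two parameters need not be
  joined by a path inside \<open>D\<close> along which finitely many Lipschitz selections could be followed.
  The two projections are compared directly instead.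

  Let \<open>x\<^sub>1 = P(v, p\<^sub>1)\<close> and \<open>x\<^sub>2 = P(v, p\<^sub>2)\<close>. By the Farkas lemma and a Caratheodory reduction
  \<open>v - x\<^sub>1\<close> is a combination of linearly independent active gradients. RCRCQ makes the same
  gradients independent at \<open>pbar\<close>, which bounds the multipliers uniformly (\<open>multipliers\<close>). The
  same device applied to the residual of a point proves a local Hoffman error bound for every
  system obtained by turning active inequalities into equations, provided the system has solutions
  close to \<open>xbar\<close> (\<open>error_bound\<close>); stability of the representation supplies those solutions.

  The error bound is used twice. First, the positive multipliers of \<open>vbar - xbar\<close> on \<open>K\<close> force the
  constraints in \<open>K\<close> to be active at every nearby projection (\<open>projection_on_face\<close>). Secondly, if
  \<open>N\<close> is the set of inequalities outside \<open>K\<close> that occur in the representation of \<open>v - x\<^sub>1\<close>, there is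
  a point \<open>y\<close> with \<open>norm (x\<^sub>1 - y) = O(norm (p\<^sub>1 - p\<^sub>2))\<close> that is feasible at \<open>p\<^sub>2\<close> and satisfies all
  constraints in \<open>I\<^sub>1 \<union> K \<union> N\<close> with equality there. Let \<open>n\<close> be the combination with the multipliers
  of \<open>v - x\<^sub>1\<close> but the gradients at \<open>p\<^sub>2\<close>. Then \<open>n \<bullet> (y - x\<^sub>2) \<ge> 0\<close> because \<open>y\<close> is on the constraints
  that \<open>n\<close> uses, while \<open>(v - x\<^sub>2) \<bullet> (y - x\<^sub>2) \<le> 0\<close> because \<open>x\<^sub>2\<close> is a projection. Subtracting,
  and using that \<open>n\<close> and \<open>y\<close> differ from \<open>v - x\<^sub>1\<close> and \<open>x\<^sub>1\<close> only by \<open>O(norm (p\<^sub>1 - p\<^sub>2))\<close>, the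
  vector \<open>x\<^sub>1 - x\<^sub>2\<close> has a nonpositive inner product with itself up to such perturbations of both
  factors, hence is of that size (\<open>projection_lipschitz_step\<close>).\<close>

section \<open>Finite systems of linear inequalities\<close>

text \<open>Bartl's algebraic induction on the number of constraints. If the implication fails once the
  constraint \<open>j\<close> is dropped, a witness \<open>d0\<close> of the failure satisfies all the other constraints and violates \<open>j\<close>. Projecting
  along \<open>d0\<close> onto the hyperplane orthogonal to \<open>a j\<close> removes the constraint \<open>j\<close>.\<close>

lemma farkas_finite:
  fixes a :: "'i \<Rightarrow> 'h::real_inner"
  assumes "finite S"
    and "\<And>d. (\<forall>i\<in>S. if i \<in> E then a i \<bullet> d = 0 else a i \<bullet> d \<le> 0) \<Longrightarrow> w \<bullet> d \<le> 0"
  shows "\<exists>\<mu>. w = (\<Sum>i\<in>S. \<mu> i *\<^sub>R a i) \<and> (\<forall>i\<in>S - E. \<mu> i \<ge> 0)"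
  using assms
proof (induction S arbitrary: a w rule: finite_induct)
  case empty
  then have "w \<bullet> w \<le> 0" by blast
  then have "w \<bullet> w = 0" using inner_ge_zero[of w] by linarith
  then show ?case by simp
next
  case (insert j S)
  show ?case
  proof (cases "\<forall>d. (\<forall>i\<in>S. if i \<in> E then a i \<bullet> d = 0 else a i \<bullet> d \<le> 0) \<longrightarrow> w \<bullet> d \<le> 0")
    case True
    then obtain \<mu> where \<mu>: "w = (\<Sum>i\<in>S. \<mu> i *\<^sub>R a i)" "\<forall>i\<in>S - E. \<mu> i \<ge> 0"
      using insert.IH[of a w] by blast
    have "(\<Sum>i\<in>insert j S. (\<mu>(j := 0)) i *\<^sub>R a i) = (\<Sum>i\<in>S. \<mu> i *\<^sub>R a i)"
      using insert.hyps by (auto intro!: sum.cong)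
    then show ?thesis
      using \<mu> by (intro exI[of _ "\<mu>(j := 0)"]) auto
  next
    case False
    then obtain d0 where d0: "\<forall>i\<in>S. if i \<in> E then a i \<bullet> d0 = 0 else a i \<bullet> d0 \<le> 0"
      and wd0: "w \<bullet> d0 > 0" by force
    define t where "t = a j \<bullet> d0"
    have t: "t \<noteq> 0" "j \<notin> E \<Longrightarrow> t > 0"
      using insert.prems[of d0] d0 wd0 by (force simp: t_def split: if_splits)+
    define a' where "a' i = a i - ((a i \<bullet> d0) / t) *\<^sub>R a j" for i
    define w' where "w' = w - ((w \<bullet> d0) / t) *\<^sub>R a j"
    have "w' \<bullet> d \<le> 0" if d: "\<forall>i\<in>S. if i \<in> E then a' i \<bullet> d = 0 else a' i \<bullet> d \<le> 0" for d
    proof -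
      define d' where "d' = d - ((a j \<bullet> d) / t) *\<^sub>R d0"
      have shift: "a i \<bullet> d' = a' i \<bullet> d" for i
        by (simp add: a'_def d'_def algebra_simps)
      have "a j \<bullet> d' = 0" using t by (simp add: d'_def t_def algebra_simps)
      then have "w \<bullet> d' \<le> 0"
        using d by (intro insert.prems) (auto simp: shift)
      then show ?thesis by (simp add: w'_def d'_def algebra_simps)
    qed
    then obtain \<mu> where \<mu>: "w' = (\<Sum>i\<in>S. \<mu> i *\<^sub>R a' i)" "\<forall>i\<in>S - E. \<mu> i \<ge> 0"
      using insert.IH[of a' w'] by blast
    define s where "s = ((w \<bullet> d0) - (\<Sum>i\<in>S. \<mu> i * (a i \<bullet> d0))) / t"
    have "(\<Sum>i\<in>S. \<mu> i * (a i \<bullet> d0)) \<le> 0"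
      using d0 \<mu>(2) by (intro sum_nonpos) (force simp: mult_nonneg_nonpos split: if_splits)
    then have s: "s \<ge> 0" if "j \<notin> E"
      using t(2)[OF that] wd0 by (simp add: s_def)
    \<comment> \<open>Undoing the projection collects all contributions of \<open>a j\<close> in one coefficient \<open>s\<close>; its
      numerator is nonnegative because \<open>d0\<close> satisfies the remaining constraints.\<close>
    have "w = w' + ((w \<bullet> d0) / t) *\<^sub>R a j" by (simp add: w'_def)
    also have "w' = (\<Sum>i\<in>S. \<mu> i *\<^sub>R a i) - ((\<Sum>i\<in>S. \<mu> i * (a i \<bullet> d0)) / t) *\<^sub>R a j"
      by (simp add: \<mu>(1) a'_def scaleR_diff_right sum_subtractf scaleR_sum_left sum_divide_distrib)
    finally have "w = (\<Sum>i\<in>S. \<mu> i *\<^sub>R a i) + s *\<^sub>R a j"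
      by (simp add: s_def algebra_simps diff_divide_distrib)
    also have "\<dots> = (\<Sum>i\<in>insert j S. (\<mu>(j := s)) i *\<^sub>R a i)"
    proof -
      have "(\<Sum>i\<in>S. (\<mu>(j := s)) i *\<^sub>R a i) = (\<Sum>i\<in>S. \<mu> i *\<^sub>R a i)"
        using insert.hyps by (intro sum.cong) auto
      then show ?thesis using insert.hyps by simp
    qed
    finally show ?thesis
      using \<mu>(2) s by (intro exI[of _ "\<mu>(j := s)"]) auto
  qed
qed

lemma independent_family_iff:
  fixes a :: "'i \<Rightarrow> 'h::real_vector"
  assumes "finite S"
  shows "independent_family S a \<longleftrightarrow>
    (\<forall>c. (\<Sum>i\<in>S. c i *\<^sub>R a i) = 0 \<longrightarrow> (\<forall>i\<in>S. c i = 0))"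
proof
  assume *: "independent_family S a"
  then have inj: "inj_on a S" and ind: "independent (a ` S)"
    by (auto simp: independent_family_def)
  show "\<forall>c. (\<Sum>i\<in>S. c i *\<^sub>R a i) = 0 \<longrightarrow> (\<forall>i\<in>S. c i = 0)"
  proof (intro allI impI ballI)
    fix c i assume c: "(\<Sum>i\<in>S. c i *\<^sub>R a i) = 0" and i: "i \<in> S"
    define u where "u x = c (the_inv_into S a x)" for x
    have u: "u (a k) = c k" if "k \<in> S" for k
      using that inj by (simp add: u_def the_inv_into_f_f)
    have "(\<Sum>x\<in>a ` S. u x *\<^sub>R x) = (\<Sum>i\<in>S. c i *\<^sub>R a i)"
      using inj u by (simp add: sum.reindex)
    then have "u (a i) = 0"
      using c i ind assms unfolding dependent_finite[OF finite_imageI[OF assms]] by auto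
    then show "c i = 0" using u i by simp
  qed
next
  assume *: "\<forall>c. (\<Sum>i\<in>S. c i *\<^sub>R a i) = 0 \<longrightarrow> (\<forall>i\<in>S. c i = 0)"
  have inj: "inj_on a S"
  proof (rule inj_onI, rule ccontr)
    fix i j assume ij: "i \<in> S" "j \<in> S" "a i = a j" "i \<noteq> j"
    define c :: "'i \<Rightarrow> real" where "c k = (if k = i then 1 else 0) - (if k = j then 1 else 0)" for k
    have "c k *\<^sub>R a k = (if k = i then a k else 0) - (if k = j then a k else 0)" for k
      by (simp add: c_def)
    then have "(\<Sum>k\<in>S. c k *\<^sub>R a k) = 0"
      using ij assms by (simp add: sum_subtractf)
    then have "c i = 0" using * ij by blast
    then show False using ij by (simp add: c_def)
  qed
  have "independent (a ` S)"
    unfolding dependent_finite[OF finite_imageI[OF assms]]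
  proof clarify
    fix u i assume "(\<Sum>v\<in>a ` S. u v *\<^sub>R v) = 0" and i: "i \<in> S" "u (a i) \<noteq> 0"
    then have "(\<Sum>i\<in>S. u (a i) *\<^sub>R a i) = 0" using inj by (simp add: sum.reindex)
    then have "u (a i) = 0" using * i by (auto dest: spec[of _ "\<lambda>i. u (a i)"])
    then show False using i by simp
  qed
  then show "independent_family S a" using inj by (simp add: independent_family_def)
qed

text \<open>Caratheodory's reduction. A vanishing combination of a dependent family must involve the
  sign-constrained part \<open>A\<close>, since \<open>E\<close> alone is independent. Subtracting the multiple of it given by
  the ratio test kills one coefficient in \<open>A\<close> and keeps the others nonnegative; the coefficients on
  \<open>E\<close> may change sign freely.\<close>

lemma independent_conic_combination:
  fixes a :: "'i \<Rightarrow> 'h::real_vector"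
  assumes "finite A" and "finite E" and "E \<inter> A = {}" and "independent_family E a"
    and "w = (\<Sum>i\<in>E \<union> A. \<mu> i *\<^sub>R a i)" and "\<forall>i\<in>A. \<mu> i \<ge> 0"
  shows "\<exists>N \<nu>. N \<subseteq> A \<and> independent_family (E \<union> N) a \<and>
    w = (\<Sum>i\<in>E \<union> N. \<nu> i *\<^sub>R a i) \<and> (\<forall>i\<in>N. \<nu> i \<ge> 0)"
  using assms
proof (induction A arbitrary: \<mu> rule: finite_psubset_induct)
  case (psubset A)
  show ?case
  proof (cases "independent_family (E \<union> A) a")
    case True
    then show ?thesis using psubset.prems by blast
  next
    case False
    have fin: "finite (E \<union> A)" using psubset by auto
    from False obtain c0 k where c0: "(\<Sum>i\<in>E \<union> A. c0 i *\<^sub>R a i) = 0" "k \<in> E \<union> A" "c0 k \<noteq> 0"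
      unfolding independent_family_iff[OF fin] by blast
    have "\<exists>j\<in>A. c0 j \<noteq> 0"
    proof (rule ccontr)
      assume "\<not> ?thesis"
      then have z: "\<forall>j\<in>A. c0 j = 0" by blast
      have "(\<Sum>i\<in>E. c0 i *\<^sub>R a i) = (\<Sum>i\<in>E \<union> A. c0 i *\<^sub>R a i)"
        using fin z by (intro sum.mono_neutral_left) auto
      then show False
        using c0 z psubset.prems by (auto simp: independent_family_iff)
    qed
    then obtain k where k: "k \<in> A" "c0 k \<noteq> 0" by blast
    define c where "c i = sgn (c0 k) * c0 i" for i
    have c: "(\<Sum>i\<in>E \<union> A. c i *\<^sub>R a i) = 0" "c k > 0"
    proof -
      have "(\<Sum>i\<in>E \<union> A. c i *\<^sub>R a i) = sgn (c0 k) *\<^sub>R (\<Sum>i\<in>E \<union> A. c0 i *\<^sub>R a i)"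
        by (simp add: c_def scaleR_sum_right)
      then show "(\<Sum>i\<in>E \<union> A. c i *\<^sub>R a i) = 0" using c0 by simp
      show "c k > 0" using k by (simp add: c_def sgn_if)
    qed
    define Q where "Q = {i \<in> A. c i > 0}"
    have Q: "finite Q" "Q \<noteq> {}" using psubset.hyps k c by (auto simp: Q_def)
    then obtain j where j: "j \<in> Q" "\<And>i. i \<in> Q \<Longrightarrow> \<mu> j / c j \<le> \<mu> i / c i"
      using arg_min_if_finite[OF Q, of "\<lambda>i. \<mu> i / c i"] by (metis not_le)
    define t where "t = \<mu> j / c j"
    define \<nu> where "\<nu> i = \<mu> i - t * c i" for i
    have jA: "j \<in> A" "c j > 0" using j by (auto simp: Q_def)
    have t: "t \<ge> 0" using jA psubset.prems by (simp add: t_def)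
    have \<nu>j: "\<nu> j = 0" using jA by (simp add: \<nu>_def t_def)
    have \<nu>pos: "\<nu> i \<ge> 0" if "i \<in> A" for i
    proof (cases "c i > 0")
      case True
      then have "t \<le> \<mu> i / c i" using j that by (simp add: t_def Q_def)
      then show ?thesis using True by (simp add: \<nu>_def field_simps)
    next
      case False
      then have "t * c i \<le> 0" using t by (simp add: mult_nonneg_nonpos)
      then show ?thesis using psubset.prems that by (force simp: \<nu>_def)
    qed
    have "w = (\<Sum>i\<in>E \<union> A. \<mu> i *\<^sub>R a i) - t *\<^sub>R (\<Sum>i\<in>E \<union> A. c i *\<^sub>R a i)"
      using c psubset.prems by simp
    also have "\<dots> = (\<Sum>i\<in>E \<union> A. \<nu> i *\<^sub>R a i)"
      by (simp add: \<nu>_def scaleR_sum_right sum_subtractf scaleR_diff_left)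
    also have "\<dots> = (\<Sum>i\<in>E \<union> (A - {j}). \<nu> i *\<^sub>R a i)"
      using fin \<nu>j jA psubset.prems by (intro sum.mono_neutral_right) auto
    finally have "w = (\<Sum>i\<in>E \<union> (A - {j}). \<nu> i *\<^sub>R a i)" .
    then have "\<exists>N \<nu>. N \<subseteq> A - {j} \<and> independent_family (E \<union> N) a \<and>
        w = (\<Sum>i\<in>E \<union> N. \<nu> i *\<^sub>R a i) \<and> (\<forall>i\<in>N. \<nu> i \<ge> 0)"
      using psubset.prems jA \<nu>pos by (intro psubset.IH) auto
    then show ?thesis by blast
  qed
qed

text \<open>Equivalence of norms on the span, obtained without compactness: the Farkas lemma provides a
  biorthogonal system \<open>b\<close>, and \<open>\<mu> j\<close> is recovered from the combination by its inner product
  with \<open>b j\<close>.\<close>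

lemma independent_family_lower_bound:
  fixes a :: "'i \<Rightarrow> 'h::real_inner"
  assumes "finite S" and "independent_family S a"
  shows "\<exists>c>0. \<forall>\<mu>. c * (\<Sum>i\<in>S. \<bar>\<mu> i\<bar>) \<le> norm (\<Sum>i\<in>S. \<mu> i *\<^sub>R a i)"
proof -
  have "\<exists>b. a j \<bullet> b = 1 \<and> (\<forall>i\<in>S - {j}. a i \<bullet> b = 0)" if j: "j \<in> S" for j
  proof -
    have "\<exists>d. (\<forall>i\<in>S - {j}. a i \<bullet> d = 0) \<and> a j \<bullet> d > 0"
    proof (rule ccontr)
      assume no: "\<not> ?thesis"
      have "\<exists>\<mu>. a j = (\<Sum>i\<in>S - {j}. \<mu> i *\<^sub>R a i) \<and> (\<forall>i\<in>S - {j} - S. \<mu> i \<ge> 0)"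
        using assms(1) no by (intro farkas_finite) force+
      then obtain \<mu> where \<mu>: "a j = (\<Sum>i\<in>S - {j}. \<mu> i *\<^sub>R a i)" by blast
      have "(\<Sum>i\<in>S - {j}. (\<mu>(j := -1)) i *\<^sub>R a i) = (\<Sum>i\<in>S - {j}. \<mu> i *\<^sub>R a i)"
        by (intro sum.cong) auto
      then have "(\<Sum>i\<in>S. (\<mu>(j := -1)) i *\<^sub>R a i) = 0"
        using \<mu> assms(1) j by (simp add: sum.remove[of S j])
      then have "(\<mu>(j := -1)) j = 0"
        using assms(2) j unfolding independent_family_iff[OF assms(1)] by blast
      then show False by simp
    qed
    then obtain d where d: "\<forall>i\<in>S - {j}. a i \<bullet> d = 0" "a j \<bullet> d > 0" by blast
    then show ?thesis by (intro exI[of _ "(1 / (a j \<bullet> d)) *\<^sub>R d"]) auto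
  qed
  then obtain b where b: "\<And>j. j \<in> S \<Longrightarrow> a j \<bullet> b j = 1"
    "\<And>i j. j \<in> S \<Longrightarrow> i \<in> S - {j} \<Longrightarrow> a i \<bullet> b j = 0" by metis
  define B where "B = 1 + (\<Sum>j\<in>S. norm (b j))"
  have B: "B > 0" by (simp add: B_def add_pos_nonneg sum_nonneg)
  have "1 / B * (\<Sum>i\<in>S. \<bar>\<mu> i\<bar>) \<le> norm (\<Sum>i\<in>S. \<mu> i *\<^sub>R a i)" for \<mu>
  proof -
    let ?w = "\<Sum>i\<in>S. \<mu> i *\<^sub>R a i"
    have "\<mu> j = ?w \<bullet> b j" if j: "j \<in> S" for j
    proof -
      have "(\<Sum>i\<in>S - {j}. \<mu> i *\<^sub>R a i) \<bullet> b j = 0"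
        unfolding inner_sum_left using b(2)[OF j] by (intro sum.neutral) auto
      then show ?thesis
        using b(1)[OF j] j assms(1) by (simp add: sum.remove[of S j] inner_add_left)
    qed
    then have "\<bar>\<mu> j\<bar> \<le> norm ?w * norm (b j)" if "j \<in> S" for j
      using that by (metis Cauchy_Schwarz_ineq2)
    then have "(\<Sum>i\<in>S. \<bar>\<mu> i\<bar>) \<le> (\<Sum>i\<in>S. norm ?w * norm (b i))" by (intro sum_mono)
    also have "\<dots> \<le> norm ?w * B"
      by (simp add: B_def sum_distrib_left distrib_left)
    finally show ?thesis using B by (simp add: field_simps)
  qed
  then show ?thesis using B by (intro exI[of _ "1 / B"]) auto
qed

text \<open>Carries linear independence of gradients from a nearby parameter to the reference one under the
  constant rank condition. An independent family indexed by \<open>S\<close> has rank \<open>card S\<close>, and a family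
  indexed by \<open>S\<close> that attains this rank can neither repeat a vector nor be dependent.\<close>

lemma independent_family_if_dim_eq:
  fixes a b :: "'i \<Rightarrow> 'h::real_vector"
  assumes "finite S" and "independent_family S a" and "dim (a ` S) = dim (b ` S)"
  shows "independent_family S b"
proof -
  have "card S = dim (b ` S)"
    using assms by (metis card_image dim_eq_card_independent independent_family_def)
  moreover obtain B where B: "B \<subseteq> b ` S" "independent B" "b ` S \<subseteq> span B" "card B = dim (b ` S)"
    by (meson basis_exists)
  moreover have "card B \<le> card (b ` S)" using B assms by (intro card_mono) auto
  moreover have "card (b ` S) \<le> card S" using assms by (simp add: card_image_le)
  ultimately have "card (b ` S) = card S" "card B = card (b ` S)" by auto
  then show ?thesis
    using B assms by (metis card_subset_eq eq_card_imp_inj_on finite_imageI independent_family_def)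
qed

section \<open>Projections in Hilbert space\<close>

text \<open>The near-minimisers of the distance form a decreasing sequence of closed sets, and by the
  parallelogram identity their diameters tend to zero; completeness then gives a common point.\<close>

lemma metric_projection_exists:
  fixes S :: "'h::{real_inner,complete_space} set"
  assumes "closed S" and "convex S" and "S \<noteq> {}"
  shows "\<exists>x\<in>S. \<forall>y\<in>S. dist v x \<le> dist v y"
proof -
  define d where "d = (INF y\<in>S. (dist v y)\<^sup>2)"
  have bdd: "bdd_below ((\<lambda>y. (dist v y)\<^sup>2) ` S)" by (intro bdd_belowI[of _ 0]) auto
  then have low: "d \<le> (dist v y)\<^sup>2" if "y \<in> S" for y
    unfolding d_def using that by (rule cINF_lower)
  define T where "T n = {y \<in> S. (dist v y)\<^sup>2 \<le> d + 1 / Suc n}" for n :: nat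
  obtain x where x: "\<And>n. x \<in> T n"
  proof (rule decreasing_closed_nest[of T])
    fix n
    have "T n = S \<inter> (\<lambda>y. (dist v y)\<^sup>2) -` {..d + 1 / Suc n}" by (auto simp: T_def)
    then show "closed (T n)"
      using assms(1) by (auto intro!: closed_Int closed_vimage continuous_intros)
    have "\<exists>y\<in>S. (dist v y)\<^sup>2 < d + 1 / Suc n"
      using bdd assms(3) cINF_less_iff[of S "\<lambda>y. (dist v y)\<^sup>2" "d + 1 / Suc n"] by (simp add: d_def)
    then show "T n \<noteq> {}" by (force simp: T_def)
  next
    fix m n :: nat assume "m \<le> n"
    then have "1 / real (Suc n) \<le> 1 / real (Suc m)" by (simp add: frac_le)
    then show "T n \<subseteq> T m" by (auto simp: T_def)
  next
    fix e :: real assume e: "e > 0"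
    obtain n :: nat where n: "4 / e\<^sup>2 < real n" using reals_Archimedean2 by blast
    show "\<exists>n. \<forall>x\<in>T n. \<forall>y\<in>T n. dist x y < e"
    proof (intro exI ballI)
      fix x y assume xy: "x \<in> T n" "y \<in> T n"
      define z where "z = (1/2) *\<^sub>R x + (1/2) *\<^sub>R y"
      have "z \<in> S" using xy assms(2) unfolding z_def T_def by (auto intro: convexD)
      then have "d \<le> (dist v z)\<^sup>2" by (rule low)
      moreover have "4 * (dist v z)\<^sup>2 + (dist x y)\<^sup>2 = 2 * (dist v x)\<^sup>2 + 2 * (dist v y)\<^sup>2"
        unfolding z_def dist_norm power2_norm_eq_inner
        by (simp add: inner_commute algebra_simps)
      ultimately have "(dist x y)\<^sup>2 \<le> 4 / Suc n" using xy by (simp add: T_def)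
      also have "\<dots> < e\<^sup>2"
      proof -
        have "4 < real n * e\<^sup>2" using n e by (simp add: field_simps)
        also have "\<dots> \<le> real (Suc n) * e\<^sup>2" by (intro mult_right_mono) auto
        finally show ?thesis using e by (simp add: field_simps)
      qed
      finally show "dist x y < e" using e by (auto intro: power2_less_imp_less)
    qed
  qed (use that in blast)
  have "(dist v x)\<^sup>2 \<le> d"
  proof (rule field_le_epsilon)
    fix e :: real assume "e > 0"
    then obtain n where "1 / real (Suc n) < e" using nat_approx_posE by blast
    then show "(dist v x)\<^sup>2 \<le> d + e" using x[of n] by (simp add: T_def)
  qed
  then have "dist v x \<le> dist v y" if "y \<in> S" for y
    using low[OF that] by (meson order_trans power2_le_imp_le zero_le_dist)
  then show ?thesis using x[of 0] by (auto simp: T_def)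
qed

lemma metric_projection:
  fixes S :: "'h::{real_inner,complete_space} set"
  assumes "closed S" and "convex S" and "S \<noteq> {}"
  shows metric_projection_mem: "metric_projection S v \<in> S"
    and metric_projection_variational:
      "y \<in> S \<Longrightarrow> (v - metric_projection S v) \<bullet> (y - metric_projection S v) \<le> 0"
proof -
  obtain x where x: "x \<in> S" "\<forall>y\<in>S. dist v x \<le> dist v y"
    using metric_projection_exists[OF assms] by blast
  have "z = x" if z: "z \<in> S" "\<forall>y\<in>S. dist v z \<le> dist v y" for z
  proof -
    have "(v - x) \<bullet> (z - x) \<le> 0" "(v - z) \<bullet> (x - z) \<le> 0"
      using any_closest_point_dot assms(1,2) x z by blast+
    then have "(z - x) \<bullet> (z - x) \<le> 0" by (simp add: inner_commute algebra_simps)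
    then have "(z - x) \<bullet> (z - x) = 0" using inner_ge_zero[of "z - x"] by linarith
    then show ?thesis by simp
  qed
  then have eq: "metric_projection S v = x"
    unfolding metric_projection_def using x by (intro the_equality conjI) blast+
  show "metric_projection S v \<in> S" using x eq by simp
  show "(v - metric_projection S v) \<bullet> (y - metric_projection S v) \<le> 0" if "y \<in> S"
    unfolding eq using any_closest_point_dot[OF assms(2,1) x(1) that x(2)] .
qed

lemma reflected_projection_nonexpansive:
  fixes S :: "'h::{real_inner,complete_space} set"
  assumes "closed S" and "convex S" and "S \<noteq> {}"
  shows "norm ((v - w) - 2 *\<^sub>R (metric_projection S v - metric_projection S w)) \<le> norm (v - w)"
proof -
  define x y where "x = metric_projection S v" and "y = metric_projection S w"
  have "(v - x) \<bullet> (y - x) \<le> 0" "(w - y) \<bullet> (x - y) \<le> 0"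
    unfolding x_def y_def by (intro metric_projection[OF assms])+
  then have "(norm ((v - w) - 2 *\<^sub>R (x - y)))\<^sup>2 \<le> (norm (v - w))\<^sup>2"
    unfolding power2_norm_eq_inner by (simp add: inner_commute algebra_simps)
  then have "norm ((v - w) - 2 *\<^sub>R (x - y)) \<le> norm (v - w)"
    by (rule power2_le_imp_le) simp
  then show ?thesis by (simp add: x_def y_def)
qed

section \<open>Polyhedral sets and their normal vectors\<close>

lemma closed_polyhedral_set: "closed (polyhedral_set E A f g p)"
proof -
  have "polyhedral_set E A f g p =
    (\<Inter>i\<in>E. {x. x \<bullet> g i p = f i p}) \<inter> (\<Inter>i\<in>A. {x. x \<bullet> g i p \<le> f i p})"
    by (auto simp: polyhedral_set_def)
  then show ?thesis
    by (auto intro!: closed_Int closed_INT closed_Collect_eq closed_Collect_le continuous_intros)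
qed

lemma convex_polyhedral_set: "convex (polyhedral_set E A f g p)"
proof -
  have "polyhedral_set E A f g p =
    (\<Inter>i\<in>E. {x. g i p \<bullet> x = f i p}) \<inter> (\<Inter>i\<in>A. {x. g i p \<bullet> x \<le> f i p})"
    by (auto simp: polyhedral_set_def inner_commute)
  then show ?thesis
    by (auto intro!: convex_Int convex_INT convex_hyperplane convex_halfspace_le)
qed

text \<open>The Karush-Kuhn-Tucker conditions with an independent set of active gradients. A direction that
  satisfies the linearised equations and active inequalities can be followed for a short time
  inside the set, since the finitely many inactive constraints keep some slack; so \<open>w\<close> is
  nonpositive on it and the Farkas lemma applies.\<close>

lemma polyhedral_normal_representation:
  fixes g :: "'i \<Rightarrow> 'g \<Rightarrow> 'h::real_inner"
  assumes fin: "finite E" "finite A" and "E \<inter> A = {}"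
    and ind: "independent_family E (\<lambda>i. g i p)"
    and y: "y \<in> polyhedral_set E A f g p"
    and normal: "\<And>z. z \<in> polyhedral_set E A f g p \<Longrightarrow> w \<bullet> (z - y) \<le> 0"
  shows "\<exists>N \<mu>. N \<subseteq> A \<and> (\<forall>i\<in>N. y \<bullet> g i p = f i p) \<and>
    independent_family (E \<union> N) (\<lambda>i. g i p) \<and>
    w = (\<Sum>i\<in>E \<union> N. \<mu> i *\<^sub>R g i p) \<and> (\<forall>i\<in>N. \<mu> i \<ge> 0)"
proof -
  define T where "T = {i \<in> A. y \<bullet> g i p = f i p}"
  have "\<exists>\<mu>. w = (\<Sum>i\<in>E \<union> T. \<mu> i *\<^sub>R g i p) \<and> (\<forall>i\<in>(E \<union> T) - E. \<mu> i \<ge> 0)"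
  proof (rule farkas_finite)
    show "finite (E \<union> T)" using fin by (simp add: T_def)
    fix d assume d: "\<forall>i\<in>E \<union> T. if i \<in> E then g i p \<bullet> d = 0 else g i p \<bullet> d \<le> 0"
    have "\<forall>\<^sub>F t in at_right 0. (y + t *\<^sub>R d) \<bullet> g i p \<le> f i p" if i: "i \<in> A" for i
    proof (cases "i \<in> T")
      case True
      then have "g i p \<bullet> d \<le> 0" "i \<notin> E" using d assms(3) i by (auto split: if_splits)
      moreover have "(y + t *\<^sub>R d) \<bullet> g i p = f i p + t * (g i p \<bullet> d)" for t
        using True by (simp add: T_def inner_add_left inner_commute[of d])
      ultimately have "(y + t *\<^sub>R d) \<bullet> g i p \<le> f i p" if "t > 0" for t
        using that by (simp add: mult_nonneg_nonpos)
      then show ?thesis by (auto simp: eventually_at_filter)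
    next
      case False
      then have "y \<bullet> g i p < f i p" using i y by (force simp: T_def polyhedral_set_def)
      moreover have "((\<lambda>t. (y + t *\<^sub>R d) \<bullet> g i p) \<longlongrightarrow> (y + 0 *\<^sub>R d) \<bullet> g i p) (at_right 0)"
        by (intro tendsto_intros)
      ultimately have "\<forall>\<^sub>F t in at_right 0. (y + t *\<^sub>R d) \<bullet> g i p < f i p"
        by (intro order_tendstoD) auto
      then show ?thesis by eventually_elim simp
    qed
    then have "\<forall>\<^sub>F t in at_right 0. \<forall>i\<in>A. (y + t *\<^sub>R d) \<bullet> g i p \<le> f i p"
      using fin by (intro eventually_ball_finite) auto
    moreover have "\<forall>\<^sub>F t in at_right (0::real). t > 0" by (simp add: eventually_at_right_less)
    ultimately have "\<forall>\<^sub>F t in at_right (0::real). w \<bullet> d \<le> 0"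
    proof eventually_elim
      case (elim t)
      have "\<forall>i\<in>E. (y + t *\<^sub>R d) \<bullet> g i p = f i p"
        using d y by (auto simp: polyhedral_set_def inner_add_left inner_commute[of d] split: if_splits)
      then have "w \<bullet> ((y + t *\<^sub>R d) - y) \<le> 0"
        using elim by (intro normal) (simp add: polyhedral_set_def)
      then show ?case using elim by (simp add: mult_le_0_iff)
    qed
    then show "w \<bullet> d \<le> 0" by simp
  qed
  then obtain \<mu> where "w = (\<Sum>i\<in>E \<union> T. \<mu> i *\<^sub>R g i p)" "\<forall>i\<in>(E \<union> T) - E. \<mu> i \<ge> 0" by blast
  then have "\<exists>N \<nu>. N \<subseteq> T \<and> independent_family (E \<union> N) (\<lambda>i. g i p) \<and>
      w = (\<Sum>i\<in>E \<union> N. \<nu> i *\<^sub>R g i p) \<and> (\<forall>i\<in>N. \<nu> i \<ge> 0)"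
    using fin assms(3) ind
    by (intro independent_conic_combination[where \<mu>=\<mu>]) (auto simp: T_def)
  then show ?thesis by (auto simp: T_def)
qed

section \<open>Neighbourhoods relative to a set\<close>

lemma lower_limit_eventually:
  fixes F :: "'g::metric_space \<Rightarrow> 'h::metric_space set"
  assumes y: "y \<in> lower_limit D F pbar" and e: "e > 0"
  shows "\<forall>\<^sub>F p in inf (nhds pbar) (principal D). \<exists>z\<in>F p. dist z y < e"
proof (rule ccontr)
  assume not: "\<not> ?thesis"
  have "\<exists>p\<in>D. dist p pbar < 1 / Suc n \<and> (\<forall>z\<in>F p. \<not> dist z y < e)" for n :: nat
  proof (rule ccontr)
    assume "\<not> ?thesis"
    then have "\<forall>p. dist p pbar < 1 / Suc n \<longrightarrow> p \<in> D \<longrightarrow> (\<exists>z\<in>F p. dist z y < e)" by blast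
    then show False
      using not unfolding eventually_inf_principal eventually_nhds_metric
      by (meson of_nat_0_less_iff zero_less_Suc zero_less_divide_1_iff)
  qed
  then obtain pk where pk: "\<And>n::nat. pk n \<in> D" "\<And>n. dist (pk n) pbar < 1 / Suc n"
    "\<And>n z. z \<in> F (pk n) \<Longrightarrow> \<not> dist z y < e" by metis
  have "pk \<longlonglongrightarrow> pbar"
  proof (rule metric_LIMSEQ_I)
    fix r :: real assume "r > 0"
    then obtain n where n: "1 / real (Suc n) < r" using nat_approx_posE by blast
    have "dist (pk m) pbar < r" if "m \<ge> n" for m
    proof -
      have "1 / real (Suc m) \<le> 1 / real (Suc n)" using that by (simp add: frac_le)
      then show ?thesis using pk(2)[of m] n by linarith
    qed
    then show "\<exists>n. \<forall>m\<ge>n. dist (pk m) pbar < r" by blast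
  qed
  then obtain yk where "\<And>k. yk k \<in> F (pk k)" "yk \<longlonglongrightarrow> y"
    using y pk(1) unfolding lower_limit_def by blast
  then show False using pk(3) e metric_LIMSEQ_D by (metis order_refl)
qed

lemma eventually_in_openin:
  fixes pbar :: "'g::metric_space"
  assumes "openin (top_of_set D) U" and "pbar \<in> U"
  shows "\<forall>\<^sub>F p in inf (nhds pbar) (principal D). p \<in> U"
proof -
  obtain T where T: "open T" "U = D \<inter> T" using assms(1) by (auto simp: openin_open)
  then have "\<forall>\<^sub>F p in nhds pbar. p \<in> T" using assms(2) by (intro eventually_nhds_in_open) auto
  then show ?thesis using T by (auto simp: eventually_inf_principal elim: eventually_mono)
qed

lemma eventually_imp_openin:
  assumes "\<forall>\<^sub>F p in inf (nhds pbar) (principal D). P p" and "pbar \<in> D"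
  shows "\<exists>U. openin (top_of_set D) U \<and> pbar \<in> U \<and> (\<forall>p\<in>U. p \<in> D \<and> P p)"
proof -
  obtain T where "open T" "pbar \<in> T" "\<forall>p\<in>T. p \<in> D \<longrightarrow> P p"
    using assms(1) unfolding eventually_inf_principal eventually_nhds by blast
  then show ?thesis using assms(2) by (intro exI[of _ "D \<inter> T"]) auto
qed

lemma eventually_prod_nhds_ball:
  fixes x :: "'h::metric_space"
  assumes "\<forall>\<^sub>F (p, y) in F \<times>\<^sub>F nhds x. P p y"
  shows "\<exists>r>0. \<forall>\<^sub>F p in F. \<forall>y\<in>ball x r. P p y"
proof -
  obtain Q S where QS: "eventually Q F" "eventually S (nhds x)" "\<And>p y. Q p \<Longrightarrow> S y \<Longrightarrow> P p y"
    using assms unfolding eventually_prod_filter by auto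
  then obtain r where "r > 0" "\<And>y. dist y x < r \<Longrightarrow> S y"
    unfolding eventually_nhds_metric by blast
  then show ?thesis
    using QS by (intro exI[of _ r]) (auto elim!: eventually_mono simp: dist_commute)
qed

lemma locally_lipschitz_family:
  assumes "finite I" and "p \<in> D" and "\<forall>i\<in>I. locally_lipschitz_on D (h i)"
  shows "\<exists>u>0. \<exists>L>0. \<forall>i\<in>I. L-lipschitz_on (cball p u \<inter> D) (h i)"
  using assms(1,3)
proof (induction I)
  case empty
  then show ?case by (auto intro: exI[of _ 1])
next
  case (insert j I)
  then obtain u L where u: "u > 0" "L > 0" "\<forall>i\<in>I. L-lipschitz_on (cball p u \<inter> D) (h i)" by auto
  obtain u' L' where u': "u' > 0" "L'-lipschitz_on (cball p u' \<inter> D) (h j)"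
    using insert.prems assms(2) unfolding locally_lipschitz_on_def by blast
  have "(max L L')-lipschitz_on (cball p (min u u') \<inter> D) (h i)" if "i \<in> insert j I" for i
    using that u(3) u'(2) by (auto elim!: lipschitz_on_mono)
  then show ?case using u u' by (intro exI[of _ "min u u'"] conjI exI[of _ "max L L'"]) auto
qed

lemma locally_lipschitz_on_tendsto:
  assumes "locally_lipschitz_on D h" and "p \<in> D"
  shows "(h \<longlongrightarrow> h p) (inf (nhds p) (principal D))"
proof -
  obtain u L where u: "u > 0" and L: "L-lipschitz_on (cball p u \<inter> D) h"
    using assms unfolding locally_lipschitz_on_def by blast
  have "((\<lambda>q. q) \<longlongrightarrow> p) (inf (nhds p) (principal D))"
    by (rule tendsto_mono[OF inf_le1 filterlim_ident])
  then have lim: "((\<lambda>q. L * dist q p) \<longlongrightarrow> L * dist p p) (inf (nhds p) (principal D))"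
    by (intro tendsto_intros)
  have near: "\<forall>\<^sub>F q in inf (nhds p) (principal D). dist (h q) (h p) \<le> L * dist q p"
    unfolding eventually_inf_principal eventually_nhds_metric
    using u assms(2)
    by (intro exI[of _ u]) (auto simp: dist_commute intro!: lipschitz_onD[OF L])
  show ?thesis
  proof (rule tendstoI)
    fix e :: real assume "e > 0"
    then have "\<forall>\<^sub>F q in inf (nhds p) (principal D). L * dist q p < e"
      using order_tendstoD(2)[OF lim, of e] by simp
    with near show "\<forall>\<^sub>F q in inf (nhds p) (principal D). dist (h q) (h p) < e"
      by eventually_elim simp
  qed
qed

section \<open>Systems with relaxed constant rank\<close>

text \<open>This locale concerns the feasible sets near \<open>xbar\<close> only; the point \<open>vbar\<close> to be projected enters
  in the next section.\<close>

locale rcrcq_system =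
  fixes D :: "'g::metric_space set"
    and I\<^sub>1 I\<^sub>2 :: "'i set"
    and f :: "'i \<Rightarrow> 'g \<Rightarrow> real"
    and g :: "'i \<Rightarrow> 'g \<Rightarrow> 'h::{real_inner,complete_space}"
    and pbar :: 'g and xbar :: 'h
  assumes pbar_in: "pbar \<in> D"
    and disjoint: "I\<^sub>1 \<inter> I\<^sub>2 = {}"
    and finite_index: "finite (I\<^sub>1 \<union> I\<^sub>2)"
    and lipschitz_f: "\<And>i. i \<in> I\<^sub>1 \<union> I\<^sub>2 \<Longrightarrow> locally_lipschitz_on D (f i)"
    and lipschitz_g: "\<And>i. i \<in> I\<^sub>1 \<union> I\<^sub>2 \<Longrightarrow> locally_lipschitz_on D (g i)"
    and rcrcq: "RCRCQ D I\<^sub>1 I\<^sub>2 f g pbar xbar"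
    and xbar_in: "xbar \<in> polyhedral_set I\<^sub>1 I\<^sub>2 f g pbar"
begin

abbreviation near :: "'g filter" where
  "near \<equiv> inf (nhds pbar) (principal D)"

abbreviation active :: "'i set" where
  "active \<equiv> active_set I\<^sub>1 I\<^sub>2 f g pbar xbar"

text \<open>The feasible set with the inequalities in \<open>M\<close> turned into equations. It is meant for sets \<open>M\<close>
  that contain \<open>I\<^sub>1\<close>; for \<open>M = I\<^sub>1\<close> it is the feasible set itself.\<close>

abbreviation face :: "'i set \<Rightarrow> 'g \<Rightarrow> 'h set" where
  "face M p \<equiv> polyhedral_set M (I\<^sub>2 - M) f g p"

lemma active_subset: "active \<subseteq> I\<^sub>1 \<union> I\<^sub>2"
  by (auto simp: active_set_def)

lemma finite_indices: "S \<subseteq> I\<^sub>1 \<union> I\<^sub>2 \<Longrightarrow> finite S"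
  by (rule finite_subset[OF _ finite_index])

lemma tendsto_data:
  assumes "i \<in> I\<^sub>1 \<union> I\<^sub>2"
  shows "(f i \<longlongrightarrow> f i pbar) near" and "(g i \<longlongrightarrow> g i pbar) near"
  by (intro locally_lipschitz_on_tendsto lipschitz_f lipschitz_g pbar_in assms)+

lemma face_subset:
  assumes "I\<^sub>1 \<subseteq> M" and "M \<subseteq> I\<^sub>1 \<union> I\<^sub>2"
  shows "face M p \<subseteq> polyhedral_set I\<^sub>1 I\<^sub>2 f g p"
proof
  fix x assume x: "x \<in> face M p"
  have "x \<bullet> g i p \<le> f i p" if "i \<in> I\<^sub>2" for i
    using x that by (cases "i \<in> M") (auto simp: polyhedral_set_def)
  then show "x \<in> polyhedral_set I\<^sub>1 I\<^sub>2 f g p" using x assms by (auto simp: polyhedral_set_def)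
qed

lemma active_near:
  "\<exists>r>0. \<forall>\<^sub>F p in near. \<forall>x\<in>ball xbar r. \<forall>i\<in>I\<^sub>1 \<union> I\<^sub>2. x \<bullet> g i p = f i p \<longrightarrow> i \<in> active"
proof (rule eventually_prod_nhds_ball)
  have "\<forall>\<^sub>F z in near \<times>\<^sub>F nhds xbar. snd z \<bullet> g i (fst z) = f i (fst z) \<longrightarrow> i \<in> active"
    if i: "i \<in> I\<^sub>1 \<union> I\<^sub>2" for i
  proof (cases "i \<in> active")
    case True
    then show ?thesis by simp
  next
    case False
    have fst: "((\<lambda>z. f i (fst z)) \<longlongrightarrow> f i pbar) (near \<times>\<^sub>F nhds xbar)"
      "((\<lambda>z. g i (fst z)) \<longlongrightarrow> g i pbar) (near \<times>\<^sub>F nhds xbar)"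
      by (rule filterlim_compose[OF tendsto_data(1)[OF i] filterlim_fst]
          filterlim_compose[OF tendsto_data(2)[OF i] filterlim_fst])+
    have "((\<lambda>z. snd z \<bullet> g i (fst z) - f i (fst z)) \<longlongrightarrow> xbar \<bullet> g i pbar - f i pbar)
      (near \<times>\<^sub>F nhds xbar)"
      by (intro tendsto_intros fst filterlim_snd)
    moreover have "xbar \<bullet> g i pbar - f i pbar \<noteq> 0" using False i by (auto simp: active_set_def)
    ultimately have "\<forall>\<^sub>F z in near \<times>\<^sub>F nhds xbar. snd z \<bullet> g i (fst z) - f i (fst z) \<noteq> 0"
      by (rule tendsto_imp_eventually_ne)
    then show ?thesis by eventually_elim simp
  qed
  then have "\<forall>\<^sub>F z in near \<times>\<^sub>F nhds xbar. \<forall>i\<in>I\<^sub>1 \<union> I\<^sub>2.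
      snd z \<bullet> g i (fst z) = f i (fst z) \<longrightarrow> i \<in> active"
    using finite_index by (intro eventually_ball_finite) auto
  then show "\<forall>\<^sub>F (p, x) in near \<times>\<^sub>F nhds xbar. \<forall>i\<in>I\<^sub>1 \<union> I\<^sub>2. x \<bullet> g i p = f i p \<longrightarrow> i \<in> active"
    by (simp add: case_prod_unfold)
qed

text \<open>There are only finitely many index sets, so one constant serves all independent families at
  \<open>pbar\<close>; half of it survives a small perturbation of the gradients.\<close>

lemma lower_bound_near:
  "\<exists>c>0. \<forall>\<^sub>F p in near. \<forall>S. S \<subseteq> I\<^sub>1 \<union> I\<^sub>2 \<longrightarrow> independent_family S (\<lambda>i. g i pbar) \<longrightarrow>
     (\<forall>\<mu>. c * (\<Sum>i\<in>S. \<bar>\<mu> i\<bar>) \<le> norm (\<Sum>i\<in>S. \<mu> i *\<^sub>R g i p))"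
proof -
  have "\<exists>c>0. independent_family S (\<lambda>i. g i pbar) \<longrightarrow>
      (\<forall>\<mu>. c * (\<Sum>i\<in>S. \<bar>\<mu> i\<bar>) \<le> norm (\<Sum>i\<in>S. \<mu> i *\<^sub>R g i pbar))"
    if "S \<in> Pow (I\<^sub>1 \<union> I\<^sub>2)" for S
    using independent_family_lower_bound[OF finite_indices, of S] that zero_less_one by blast
  then obtain c where c: "\<And>S. S \<in> Pow (I\<^sub>1 \<union> I\<^sub>2) \<Longrightarrow> c S > 0"
    "\<And>S \<mu>. S \<in> Pow (I\<^sub>1 \<union> I\<^sub>2) \<Longrightarrow> independent_family S (\<lambda>i. g i pbar) \<Longrightarrow>
      c S * (\<Sum>i\<in>S. \<bar>\<mu> i\<bar>) \<le> norm (\<Sum>i\<in>S. \<mu> i *\<^sub>R g i pbar)"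
    by metis
  define e where "e = Min (c ` Pow (I\<^sub>1 \<union> I\<^sub>2)) / 2"
  have fin: "finite (c ` Pow (I\<^sub>1 \<union> I\<^sub>2))" "c ` Pow (I\<^sub>1 \<union> I\<^sub>2) \<noteq> {}"
    using finite_index by auto
  have e: "e > 0" using c(1) fin by (auto simp: e_def)
  have le: "2 * e \<le> c S" if "S \<in> Pow (I\<^sub>1 \<union> I\<^sub>2)" for S
    using fin that by (simp add: e_def)
  have "\<forall>\<^sub>F p in near. \<forall>i\<in>I\<^sub>1 \<union> I\<^sub>2. dist (g i p) (g i pbar) < e"
    using finite_index e tendsto_data(2) by (intro eventually_ball_finite) (auto intro: tendstoD)
  then have "\<forall>\<^sub>F p in near. \<forall>S. S \<subseteq> I\<^sub>1 \<union> I\<^sub>2 \<longrightarrow> independent_family S (\<lambda>i. g i pbar) \<longrightarrow>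
     (\<forall>\<mu>. e * (\<Sum>i\<in>S. \<bar>\<mu> i\<bar>) \<le> norm (\<Sum>i\<in>S. \<mu> i *\<^sub>R g i p))"
  proof eventually_elim
    case (elim p)
    show ?case
    proof (intro allI impI)
      fix S and \<mu> :: "'i \<Rightarrow> real" assume S: "S \<subseteq> I\<^sub>1 \<union> I\<^sub>2" "independent_family S (\<lambda>i. g i pbar)"
      let ?m = "\<Sum>i\<in>S. \<bar>\<mu> i\<bar>"
      have "2 * e * ?m \<le> c S * ?m"
        using le S by (intro mult_right_mono sum_nonneg) auto
      also have "\<dots> \<le> norm (\<Sum>i\<in>S. \<mu> i *\<^sub>R g i pbar)" using c(2) S by blast
      also have "(\<Sum>i\<in>S. \<mu> i *\<^sub>R g i pbar) =
          (\<Sum>i\<in>S. \<mu> i *\<^sub>R g i p) - (\<Sum>i\<in>S. \<mu> i *\<^sub>R (g i p - g i pbar))"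
        by (simp add: scaleR_diff_right sum_subtractf)
      also have "norm \<dots> \<le> norm (\<Sum>i\<in>S. \<mu> i *\<^sub>R g i p) + norm (\<Sum>i\<in>S. \<mu> i *\<^sub>R (g i p - g i pbar))"
        by (rule norm_triangle_ineq4)
      also have "norm (\<Sum>i\<in>S. \<mu> i *\<^sub>R (g i p - g i pbar)) \<le> (\<Sum>i\<in>S. \<bar>\<mu> i\<bar> * e)"
        using elim S(1) by (intro sum_norm_le) (force simp: dist_norm intro!: mult_left_mono)
      finally show "e * ?m \<le> norm (\<Sum>i\<in>S. \<mu> i *\<^sub>R g i p)"
        by (simp add: sum_distrib_right[symmetric])
    qed
  qed
  then show ?thesis using e by blast
qed

lemma rank_near:
  "\<forall>\<^sub>F p in near. \<forall>J. I\<^sub>1 \<subseteq> J \<longrightarrow> J \<subseteq> active \<longrightarrow>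
     independent_family J (\<lambda>i. g i p) \<longrightarrow> independent_family J (\<lambda>i. g i pbar)"
proof -
  obtain U where U: "openin (top_of_set D) U" "pbar \<in> U"
    "\<forall>J. I\<^sub>1 \<subseteq> J \<and> J \<subseteq> active \<longrightarrow>
      (\<forall>p\<in>U. dim ((\<lambda>i. g i p) ` J) = dim ((\<lambda>i. g i pbar) ` J))"
    using rcrcq unfolding RCRCQ_def by (elim exE conjE) (rule that)
  from eventually_in_openin[OF U(1,2)] show ?thesis
  proof eventually_elim
    case (elim p)
    show ?case
    proof (intro allI impI)
      fix J assume J: "I\<^sub>1 \<subseteq> J" "J \<subseteq> active" "independent_family J (\<lambda>i. g i p)"
      have "finite J" using J(2) active_subset by (intro finite_indices) auto
      moreover have "dim ((\<lambda>i. g i p) ` J) = dim ((\<lambda>i. g i pbar) ` J)"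
        using U(3) J(1,2) elim by simp
      ultimately show "independent_family J (\<lambda>i. g i pbar)"
        using independent_family_if_dim_eq J(3) by blast
    qed
  qed
qed

text \<open>A Karush-Kuhn-Tucker representation of the normal vector \<open>w\<close> to \<open>face M p\<close> at \<open>y\<close>, with the two
  properties that make it stable in \<open>p\<close>: the gradients used are independent at \<open>pbar\<close>, not only at
  \<open>p\<close>, and the multipliers are bounded by \<open>norm w / c\<close>.\<close>

definition bounded_multipliers :: "real \<Rightarrow> 'i set \<Rightarrow> 'g \<Rightarrow> 'h \<Rightarrow> 'h \<Rightarrow> bool" where
  "bounded_multipliers c M p y w \<longleftrightarrow>
    (\<exists>N \<mu>. N \<subseteq> I\<^sub>2 - M \<and> N \<subseteq> active \<and> (\<forall>i\<in>N. y \<bullet> g i p = f i p) \<and>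
         independent_family (M \<union> N) (\<lambda>i. g i pbar) \<and>
         w = (\<Sum>i\<in>M \<union> N. \<mu> i *\<^sub>R g i p) \<and> (\<forall>i\<in>N. \<mu> i \<ge> 0) \<and>
         c * (\<Sum>i\<in>M \<union> N. \<bar>\<mu> i\<bar>) \<le> norm w)"

text \<open>Independence of the gradients is first obtained at \<open>p\<close>, where the bound on the multipliers could
  degenerate as \<open>p\<close> tends to \<open>pbar\<close>. RCRCQ transports the independence to \<open>pbar\<close>, and the lower
  bound there is uniform in a neighbourhood.\<close>

lemma multipliers:
  assumes M: "I\<^sub>1 \<subseteq> M" "M \<subseteq> active" and ind: "independent_family M (\<lambda>i. g i pbar)"
  shows "\<exists>c>0. \<exists>r>0. \<forall>\<^sub>F p in near. \<forall>y\<in>face M p. dist xbar y < r \<longrightarrow>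
    (\<forall>w. (\<forall>z\<in>face M p. w \<bullet> (z - y) \<le> 0) \<longrightarrow> bounded_multipliers c M p y w)"
proof -
  have MI: "M \<subseteq> I\<^sub>1 \<union> I\<^sub>2" using M active_subset by blast
  obtain c where c: "c > 0" "\<forall>\<^sub>F p in near. \<forall>S. S \<subseteq> I\<^sub>1 \<union> I\<^sub>2 \<longrightarrow>
      independent_family S (\<lambda>i. g i pbar) \<longrightarrow>
      (\<forall>\<mu>. c * (\<Sum>i\<in>S. \<bar>\<mu> i\<bar>) \<le> norm (\<Sum>i\<in>S. \<mu> i *\<^sub>R g i p))"
    using lower_bound_near by blast
  obtain r where r: "r > 0"
    "\<forall>\<^sub>F p in near. \<forall>x\<in>ball xbar r. \<forall>i\<in>I\<^sub>1 \<union> I\<^sub>2. x \<bullet> g i p = f i p \<longrightarrow> i \<in> active"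
    using active_near by blast
  from c(2) r(2) rank_near have "\<forall>\<^sub>F p in near. \<forall>y\<in>face M p. dist xbar y < r \<longrightarrow>
    (\<forall>w. (\<forall>z\<in>face M p. w \<bullet> (z - y) \<le> 0) \<longrightarrow> bounded_multipliers c M p y w)"
  proof eventually_elim
    case (elim p)
    have indp: "independent_family M (\<lambda>i. g i p)"
      unfolding independent_family_iff[OF finite_indices[OF MI]]
    proof (intro allI impI)
      fix \<mu> assume "(\<Sum>i\<in>M. \<mu> i *\<^sub>R g i p) = 0"
      then have "c * (\<Sum>i\<in>M. \<bar>\<mu> i\<bar>) \<le> 0"
        using elim(1) MI ind by (metis norm_zero)
      then have "(\<Sum>i\<in>M. \<bar>\<mu> i\<bar>) \<le> 0" using c(1) by (simp add: mult_le_0_iff)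
      then have "(\<Sum>i\<in>M. \<bar>\<mu> i\<bar>) = 0" by (intro order.antisym sum_nonneg) auto
      then show "\<forall>i\<in>M. \<mu> i = 0"
        using finite_indices[OF MI] by (simp add: sum_nonneg_eq_0_iff)
    qed
    show ?case
    proof (intro ballI impI allI)
      fix y w assume y: "y \<in> face M p" "dist xbar y < r"
        and w: "\<forall>z\<in>face M p. w \<bullet> (z - y) \<le> 0"
      have "\<exists>N \<mu>. N \<subseteq> I\<^sub>2 - M \<and> (\<forall>i\<in>N. y \<bullet> g i p = f i p) \<and>
          independent_family (M \<union> N) (\<lambda>i. g i p) \<and>
          w = (\<Sum>i\<in>M \<union> N. \<mu> i *\<^sub>R g i p) \<and> (\<forall>i\<in>N. \<mu> i \<ge> 0)"
        using finite_indices[OF MI] finite_index indp y w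
        by (intro polyhedral_normal_representation) auto
      then obtain N \<mu> where N: "N \<subseteq> I\<^sub>2 - M" "\<forall>i\<in>N. y \<bullet> g i p = f i p"
        "independent_family (M \<union> N) (\<lambda>i. g i p)"
        "w = (\<Sum>i\<in>M \<union> N. \<mu> i *\<^sub>R g i p)" "\<forall>i\<in>N. \<mu> i \<ge> 0" by blast
      have act: "N \<subseteq> active" using N(1,2) elim(2) y by (auto simp: subset_iff)
      have "independent_family (M \<union> N) (\<lambda>i. g i pbar)"
        using elim(3) M act N(3) by (meson Un_least le_supI1)
      then show "bounded_multipliers c M p y w"
        unfolding bounded_multipliers_def using N act elim(1) MI active_subset
        by (intro exI[of _ N] exI[of _ \<mu>]) auto
    qed
  qed
  then show ?thesis using c(1) r(1) by blast
qed

text \<open>The Hoffman estimate for the distance from \<open>x\<close> to \<open>face M p\<close>. Letting \<open>e\<close> be any upper bound of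
  the residuals avoids a maximum over an index set that may be empty.\<close>

definition close_to_face :: "real \<Rightarrow> 'i set \<Rightarrow> 'g \<Rightarrow> 'h \<Rightarrow> bool" where
  "close_to_face c M p x \<longleftrightarrow> (\<exists>y\<in>face M p. \<forall>e\<ge>0.
    (\<forall>i\<in>M. \<bar>x \<bullet> g i p - f i p\<bar> \<le> e) \<longrightarrow> (\<forall>i\<in>I\<^sub>2 - M. x \<bullet> g i p - f i p \<le> e) \<longrightarrow>
    norm (x - y) \<le> c * e)"

lemma close_to_face_mono:
  assumes "close_to_face c M p x" and "c \<le> c'"
  shows "close_to_face c' M p x"
proof -
  have "c * e \<le> c' * e" if "e \<ge> 0" for e using assms(2) that by (rule mult_right_mono)
  then show ?thesis using assms(1) unfolding close_to_face_def by (meson order_trans)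
qed

text \<open>Let \<open>y\<close> be the projection of \<open>x\<close> onto \<open>face M p\<close>. The face has points near \<open>xbar\<close>, so \<open>y\<close> is near
  \<open>xbar\<close> as well and \<open>x - y\<close> has bounded multipliers. Pairing this representation with \<open>x - y\<close>
  expresses the square of the distance through the residuals of \<open>x\<close> at constraints that are active
  at \<open>y\<close>, so it is at most the distance times \<open>e / c\<close>.\<close>

lemma error_bound:
  assumes M: "I\<^sub>1 \<subseteq> M" "M \<subseteq> active" and ind: "independent_family M (\<lambda>i. g i pbar)"
    and liminf: "xbar \<in> lower_limit D (face M) pbar"
  shows "\<exists>c>0. \<exists>r>0. \<forall>\<^sub>F p in near. \<forall>x\<in>ball xbar r. close_to_face c M p x"
proof -
  obtain c r where c: "c > 0" and r: "r > 0" and mult: "\<forall>\<^sub>F p in near. \<forall>y\<in>face M p. dist xbar y < r \<longrightarrow>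
    (\<forall>w. (\<forall>z\<in>face M p. w \<bullet> (z - y) \<le> 0) \<longrightarrow> bounded_multipliers c M p y w)"
    using multipliers[OF M ind] by (elim exE conjE) (rule that)
  have "\<forall>\<^sub>F p in near. \<exists>z\<in>face M p. dist z xbar < r / 4"
    using r by (intro lower_limit_eventually[OF liminf]) auto
  with mult have "\<forall>\<^sub>F p in near. \<forall>x\<in>ball xbar (r / 4). close_to_face (1 / c) M p x"
  proof eventually_elim
    case (elim p)
    show ?case
    proof
      fix x assume x: "x \<in> ball xbar (r / 4)"
      from elim(2) obtain z where z: "z \<in> face M p" "dist z xbar < r / 4" by blast
      have S: "closed (face M p)" "convex (face M p)" "face M p \<noteq> {}"
        using closed_polyhedral_set convex_polyhedral_set z by auto
      obtain y where y: "y \<in> face M p" "\<forall>z\<in>face M p. dist x y \<le> dist x z"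
        using metric_projection_exists[OF S] by blast
      have var: "\<forall>z\<in>face M p. (x - y) \<bullet> (z - y) \<le> 0"
        using any_closest_point_dot[OF S(2,1)] y by blast
      have "dist xbar y \<le> dist xbar x + dist x y" by (rule dist_triangle)
      also have "dist x y \<le> dist x z" using y z by blast
      also have "dist x z \<le> dist xbar x + dist z xbar" by (metis dist_commute dist_triangle)
      finally have "dist xbar y < r" using x z r by simp
      then have "bounded_multipliers c M p y (x - y)" using elim(1) y(1) var by simp
      then obtain N \<mu> where N: "N \<subseteq> I\<^sub>2 - M" "\<forall>i\<in>N. y \<bullet> g i p = f i p"
         "x - y = (\<Sum>i\<in>M \<union> N. \<mu> i *\<^sub>R g i p)" "\<forall>i\<in>N. \<mu> i \<ge> 0"
         "c * (\<Sum>i\<in>M \<union> N. \<bar>\<mu> i\<bar>) \<le> norm (x - y)"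
        unfolding bounded_multipliers_def by blast
      have "norm (x - y) \<le> 1 / c * e" if e: "e \<ge> 0" "\<forall>i\<in>M. \<bar>x \<bullet> g i p - f i p\<bar> \<le> e"
        "\<forall>i\<in>I\<^sub>2 - M. x \<bullet> g i p - f i p \<le> e" for e
      proof -
        have "\<mu> i * ((x - y) \<bullet> g i p) \<le> \<bar>\<mu> i\<bar> * e" if i: "i \<in> M \<union> N" for i
        proof -
          have "y \<bullet> g i p = f i p" using i N(2) y(1) by (auto simp: polyhedral_set_def)
          then have eq: "(x - y) \<bullet> g i p = x \<bullet> g i p - f i p" by (simp add: inner_diff_left)
          show ?thesis
          proof (cases "i \<in> M")
            case True
            have "\<mu> i * ((x - y) \<bullet> g i p) \<le> \<bar>\<mu> i * ((x - y) \<bullet> g i p)\<bar>" by simp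
            also have "\<dots> \<le> \<bar>\<mu> i\<bar> * e"
              using e(2) True unfolding abs_mult eq by (intro mult_left_mono) auto
            finally show ?thesis .
          next
            case False
            then show ?thesis using i N(1,4) e(3) unfolding eq by (auto intro!: mult_left_mono)
          qed
        qed
        then have "(\<Sum>i\<in>M \<union> N. \<mu> i * ((x - y) \<bullet> g i p)) \<le> (\<Sum>i\<in>M \<union> N. \<bar>\<mu> i\<bar> * e)"
          by (intro sum_mono)
        moreover have "(x - y) \<bullet> (x - y) = (\<Sum>i\<in>M \<union> N. \<mu> i * ((x - y) \<bullet> g i p))"
          by (subst (2) N(3)) (simp add: inner_sum_right)
        ultimately have "norm (x - y) * norm (x - y) \<le> (\<Sum>i\<in>M \<union> N. \<bar>\<mu> i\<bar>) * e"
          by (simp add: sum_distrib_right dot_square_norm power2_eq_square)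
        also have "\<dots> \<le> (norm (x - y) / c) * e"
          using N(5) c e(1) by (intro mult_right_mono) (auto simp: field_simps)
        finally have sq: "norm (x - y) * norm (x - y) \<le> norm (x - y) * (1 / c * e)" by simp
        show ?thesis
        proof (cases "x = y")
          case True
          then show ?thesis using c e(1) by simp
        next
          case False
          then have "norm (x - y) > 0" by simp
          with sq show ?thesis by (rule mult_left_le_imp_le)
        qed
      qed
      then show "close_to_face (1 / c) M p x"
        unfolding close_to_face_def using y(1) by blast
    qed
  qed
  then show ?thesis using c r by (intro exI[of _ "1 / c"] conjI exI[of _ "r / 4"]) auto
qed

end

section \<open>Projections onto stably represented sets\<close>

text \<open>The hypothesis places \<open>u\<close> in the ball that has \<open>- w\<close> and \<open>- e\<close> as the ends of a diameter.\<close>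

lemma norm_le_if_inner_shifted_nonpos:
  fixes u w e :: "'h::real_inner"
  assumes "(u + w) \<bullet> (u + e) \<le> 0"
  shows "norm u \<le> norm w + norm e"
proof -
  have "(norm (2 *\<^sub>R u + (w + e)))\<^sup>2 - (norm (w - e))\<^sup>2 = 4 * ((u + w) \<bullet> (u + e))"
    unfolding power2_norm_eq_inner by (simp add: inner_commute algebra_simps)
  then have "(norm (2 *\<^sub>R u + (w + e)))\<^sup>2 \<le> (norm (w - e))\<^sup>2" using assms by linarith
  then have "norm (2 *\<^sub>R u + (w + e)) \<le> norm (w - e)" by (rule power2_le_imp_le) simp
  moreover have "norm (2 *\<^sub>R u) \<le> norm (2 *\<^sub>R u + (w + e)) + norm (w + e)"
    by (metis add_diff_cancel_right' norm_triangle_ineq4)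
  moreover have "norm (w - e) \<le> norm w + norm e" "norm (w + e) \<le> norm w + norm e"
    by (rule norm_triangle_ineq4 norm_triangle_ineq)+
  ultimately show ?thesis by simp
qed

text \<open>The two conditions of a stable representation. The face of \<open>I\<^sub>1 \<union> K\<close> is the one on which the
  projections of points near \<open>vbar\<close> will turn out to lie.\<close>

locale stable_system = rcrcq_system D I\<^sub>1 I\<^sub>2 f g pbar xbar
  for D :: "'g::metric_space set"
    and I\<^sub>1 I\<^sub>2 :: "'i set"
    and f :: "'i \<Rightarrow> 'g \<Rightarrow> real"
    and g :: "'i \<Rightarrow> 'g \<Rightarrow> 'h::{real_inner,complete_space}"
    and pbar :: 'g and xbar :: 'h +
  fixes vbar :: 'h and K :: "'i set" and lam :: "'i \<Rightarrow> real"
  assumes K_active: "K \<subseteq> active \<inter> I\<^sub>2"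
    and representation: "vbar - xbar = (\<Sum>i\<in>I\<^sub>1 \<union> K. lam i *\<^sub>R g i pbar)"
    and lam_pos: "\<And>i. i \<in> K \<Longrightarrow> lam i > 0"
    and independent_K: "independent_family (I\<^sub>1 \<union> K) (\<lambda>i. g i pbar)"
    and liminf: "\<And>L. L \<subseteq> (active \<inter> I\<^sub>2) - K \<Longrightarrow>
      independent_family (I\<^sub>1 \<union> K \<union> L) (\<lambda>i. g i pbar) \<Longrightarrow>
      xbar \<in> lower_limit D (face (I\<^sub>1 \<union> K \<union> L)) pbar"
begin

abbreviation feasible :: "'g \<Rightarrow> 'h set" where
  "feasible p \<equiv> polyhedral_set I\<^sub>1 I\<^sub>2 f g p"

abbreviation proj :: "'h \<Rightarrow> 'g \<Rightarrow> 'h" where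
  "proj v p \<equiv> metric_projection (feasible p) v"

lemma support_active: "I\<^sub>1 \<union> K \<subseteq> active"
  using xbar_in K_active by (auto simp: active_set_def polyhedral_set_def)

lemma support_subset: "I\<^sub>1 \<union> K \<subseteq> I\<^sub>1 \<union> I\<^sub>2"
  using support_active active_subset by blast

lemma finite_support: "finite (I\<^sub>1 \<union> K)"
  by (rule finite_indices[OF support_subset])

lemma feasible_projection:
  assumes "feasible p \<noteq> {}"
  shows "proj v p \<in> feasible p"
    and "y \<in> feasible p \<Longrightarrow> (v - proj v p) \<bullet> (y - proj v p) \<le> 0"
  using metric_projection[OF closed_polyhedral_set convex_polyhedral_set assms] by blast+

lemma feasible_near:
  assumes "e > 0"
  shows "\<forall>\<^sub>F p in near. \<exists>y\<in>feasible p. dist y xbar < e"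
proof -
  have "xbar \<in> lower_limit D (face (I\<^sub>1 \<union> K)) pbar"
    using liminf[of "{}"] independent_K by simp
  from lower_limit_eventually[OF this assms] show ?thesis
    by eventually_elim (use face_subset[of "I\<^sub>1 \<union> K"] support_subset in blast)
qed

text \<open>The representation of \<open>vbar - xbar\<close> makes it nearly a normal vector at \<open>xbar\<close> to the feasible sets
  of nearby parameters: the error is governed by the change of the data alone. This replaces a weak
  compactness argument in the proof that projections converge.\<close>

lemma normal_estimate:
  assumes "x \<in> feasible p"
  shows "(vbar - xbar) \<bullet> (x - xbar) \<le>
    (\<Sum>i\<in>I\<^sub>1 \<union> K. \<bar>lam i\<bar> * (\<bar>f i p - f i pbar\<bar> + norm (g i p - g i pbar))) * (1 + norm x)"
proof -
  have "lam i * (g i pbar \<bullet> (x - xbar)) \<le>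
      \<bar>lam i\<bar> * (\<bar>f i p - f i pbar\<bar> + norm (g i p - g i pbar)) * (1 + norm x)"
    if i: "i \<in> I\<^sub>1 \<union> K" for i
  proof -
    \<comment> \<open>The slack \<open>s\<close> at \<open>p\<close> contributes with the right sign, and \<open>t\<close> is the change of the data.\<close>
    define s where "s = f i p - x \<bullet> g i p"
    define t where "t = (f i p - f i pbar) - (g i p - g i pbar) \<bullet> x"
    have "g i pbar \<bullet> xbar = f i pbar"
      using i support_active by (auto simp: active_set_def inner_commute)
    then have eq: "g i pbar \<bullet> (x - xbar) = t - s"
      by (simp add: s_def t_def inner_diff_left inner_diff_right inner_commute)
    have "lam i * s \<ge> 0"
    proof (cases "i \<in> I\<^sub>1")
      case True
      then show ?thesis using assms by (simp add: s_def polyhedral_set_def)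
    next
      case False
      then show ?thesis
        using assms i K_active lam_pos[of i] by (auto simp: s_def polyhedral_set_def)
    qed
    moreover have "\<bar>t\<bar> \<le> (\<bar>f i p - f i pbar\<bar> + norm (g i p - g i pbar)) * (1 + norm x)"
    proof -
      have "\<bar>t\<bar> \<le> \<bar>f i p - f i pbar\<bar> + \<bar>(g i p - g i pbar) \<bullet> x\<bar>"
        unfolding t_def by (rule abs_triangle_ineq4)
      also have "\<dots> \<le> \<bar>f i p - f i pbar\<bar> + norm (g i p - g i pbar) * norm x"
        by (intro add_left_mono Cauchy_Schwarz_ineq2)
      also have "\<dots> \<le> (\<bar>f i p - f i pbar\<bar> + norm (g i p - g i pbar)) * (1 + norm x)"
        by (simp add: algebra_simps)
      finally show ?thesis .
    qed
    then have "\<bar>lam i\<bar> * \<bar>t\<bar> \<le>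
        \<bar>lam i\<bar> * ((\<bar>f i p - f i pbar\<bar> + norm (g i p - g i pbar)) * (1 + norm x))"
      by (intro mult_left_mono) auto
    moreover have "lam i * t \<le> \<bar>lam i\<bar> * \<bar>t\<bar>" by (simp add: abs_mult[symmetric])
    ultimately show ?thesis unfolding eq by (simp add: right_diff_distrib mult.assoc)
  qed
  then have "(\<Sum>i\<in>I\<^sub>1 \<union> K. lam i * (g i pbar \<bullet> (x - xbar))) \<le>
      (\<Sum>i\<in>I\<^sub>1 \<union> K. \<bar>lam i\<bar> * (\<bar>f i p - f i pbar\<bar> + norm (g i p - g i pbar)) * (1 + norm x))"
    by (intro sum_mono)
  then show ?thesis by (simp add: representation inner_sum_left sum_distrib_right)
qed

text \<open>Continuity of the projection at \<open>(vbar, pbar)\<close>, as a quadratic inequality for the norm of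
  \<open>u = proj v p - xbar\<close>: the variational inequality is tested with a feasible point \<open>y\<close> near \<open>xbar\<close>,
  and the only term that is not small by itself, \<open>(vbar - xbar) \<bullet> u\<close>, is bounded by
  \<open>normal_estimate\<close>.\<close>

lemma projection_near:
  assumes e: "e > 0"
  shows "\<exists>r>0. \<forall>\<^sub>F p in near. feasible p \<noteq> {} \<and> (\<forall>v\<in>ball vbar r. dist xbar (proj v p) < e)"
proof -
  define \<eta> where
    "\<eta> p = (\<Sum>i\<in>I\<^sub>1 \<union> K. \<bar>lam i\<bar> * (\<bar>f i p - f i pbar\<bar> + norm (g i p - g i pbar)))" for p
  define n where "n = vbar - xbar"
  define B where "B = 2 + norm xbar + norm n"
  \<comment> \<open>The test below gives \<open>norm u * (norm u - 3 * \<theta>) \<le> \<theta> * B\<close>. With \<open>\<theta> \<le> e / 6\<close> the left-hand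
    side is at least \<open>e\<^sup>2 / 2\<close> if \<open>norm u \<ge> e\<close>, and the right-hand side is at most \<open>e\<^sup>2 / 4\<close>.\<close>
  define \<theta> where "\<theta> = min 1 (min (e / 6) (e\<^sup>2 / (4 * B)))"
  have B: "B > 0" by (simp add: B_def add_pos_nonneg)
  have \<theta>: "\<theta> > 0" "\<theta> \<le> 1" "\<theta> \<le> e / 6" "\<theta> \<le> e\<^sup>2 / (4 * B)"
    using e B by (auto simp: \<theta>_def)
  have \<theta>B: "\<theta> * B \<le> e\<^sup>2 / 4" using \<theta>(4) B by (simp add: field_simps)
  have "(\<eta> \<longlongrightarrow> (\<Sum>i\<in>I\<^sub>1 \<union> K. \<bar>lam i\<bar> * (\<bar>f i pbar - f i pbar\<bar> + norm (g i pbar - g i pbar)))) near"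
    unfolding \<eta>_def using support_subset by (intro tendsto_intros tendsto_data) auto
  then have "\<forall>\<^sub>F p in near. \<eta> p < \<theta>" using \<theta>(1) by (auto dest!: order_tendstoD(2))
  with feasible_near[OF \<theta>(1)]
  have "\<forall>\<^sub>F p in near. feasible p \<noteq> {} \<and> (\<forall>v\<in>ball vbar \<theta>. dist xbar (proj v p) < e)"
  proof eventually_elim
    case (elim p)
    then obtain y where y: "y \<in> feasible p" "dist y xbar < \<theta>" by blast
    have "dist xbar (proj v p) < e" if v: "v \<in> ball vbar \<theta>" for v
    proof (rule ccontr)
      define x where "x = proj v p"
      define u where "u = x - xbar"
      define e1 where "e1 = y - xbar"
      define e2 where "e2 = v - vbar"
      assume "\<not> dist xbar (proj v p) < e"
      then have u: "norm u \<ge> e" by (simp add: u_def x_def dist_norm norm_minus_commute)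
      have e1: "norm e1 \<le> \<theta>" using y by (simp add: e1_def dist_norm)
      have e2: "norm e2 \<le> \<theta>" using v by (simp add: e2_def dist_norm norm_minus_commute)
      have x: "x \<in> feasible p" "(v - x) \<bullet> (y - x) \<le> 0"
        unfolding x_def using feasible_projection y by blast+
      have eqs: "v - x = n + e2 - u" "y - x = e1 - u"
        by (simp_all add: n_def e1_def e2_def u_def)
      have "(n + e2 - u) \<bullet> (e1 - u) \<le> 0" using x(2) unfolding eqs .
      then have "u \<bullet> u \<le> n \<bullet> u + (- (n \<bullet> e1)) + (- (e2 \<bullet> e1)) + e1 \<bullet> u + e2 \<bullet> u"
        by (simp add: inner_commute algebra_simps)
      moreover have "n \<bullet> u \<le> \<theta> * (1 + norm xbar + norm u)"
      proof -
        have "n \<bullet> u \<le> \<eta> p * (1 + norm x)"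
          using normal_estimate[OF x(1)] by (simp add: n_def u_def \<eta>_def)
        also have "\<dots> \<le> \<theta> * (1 + norm x)" using elim(2) by (intro mult_right_mono) auto
        also have "norm x \<le> norm xbar + norm u"
          using norm_triangle_ineq[of xbar u] by (simp add: u_def)
        finally show ?thesis using \<theta>(1) by (simp add: add.assoc)
      qed
      moreover have "- (n \<bullet> e1) \<le> norm n * \<theta>"
      proof -
        have "- (n \<bullet> e1) \<le> norm n * norm e1" using Cauchy_Schwarz_ineq2[of n e1] by linarith
        also have "\<dots> \<le> norm n * \<theta>" using e1 by (intro mult_left_mono) auto
        finally show ?thesis .
      qed
      moreover have "- (e2 \<bullet> e1) \<le> \<theta>"
      proof -
        have "- (e2 \<bullet> e1) \<le> norm e2 * norm e1" using Cauchy_Schwarz_ineq2[of e2 e1] by linarith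
        also have "\<dots> \<le> 1 * \<theta>" using e1 e2 \<theta>(2) by (intro mult_mono) auto
        finally show ?thesis by simp
      qed
      moreover have "e1 \<bullet> u \<le> \<theta> * norm u" "e2 \<bullet> u \<le> \<theta> * norm u"
        using e1 e2 norm_cauchy_schwarz[of e1 u] norm_cauchy_schwarz[of e2 u]
        by (meson mult_right_mono norm_ge_zero order_trans)+
      ultimately have "norm u * norm u \<le> 3 * \<theta> * norm u + \<theta> * B"
        by (simp add: B_def dot_square_norm power2_eq_square algebra_simps)
      then have "norm u * (norm u - 3 * \<theta>) \<le> e\<^sup>2 / 4" using \<theta>B by (simp add: algebra_simps)
      moreover have "e * (e / 2) \<le> norm u * (norm u - 3 * \<theta>)"
        using u \<theta>(3) e by (intro mult_mono) auto
      ultimately have "e * e \<le> 0" by (simp add: power2_eq_square)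
      then show False using e by (simp add: mult_le_0_iff)
    qed
    then show ?case using y(1) by blast
  qed
  then show ?thesis using \<theta>(1) by blast
qed

text \<open>Complementarity persists. Let \<open>s\<close> be the total slack of \<open>x = proj v p\<close> at the constraints in \<open>K\<close>.
  The error bound yields a feasible \<open>y\<close> on the face with \<open>norm (x - y) \<le> c * s\<close>. Moving from \<open>x\<close> to
  \<open>y\<close> gains at least \<open>\<kappa> * s\<close> against the vector \<open>n p\<close>, where \<open>\<kappa>\<close> bounds the multipliers on \<open>K\<close> from
  below; but it gains nothing against \<open>v - x\<close>, which is as close to \<open>n p\<close> as desired. Both together
  force \<open>s = 0\<close>.\<close>

lemma projection_on_face:
  "\<exists>r>0. \<forall>\<^sub>F p in near. \<forall>v\<in>ball vbar r. proj v p \<in> face (I\<^sub>1 \<union> K) p"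
proof -
  let ?M = "I\<^sub>1 \<union> K"
  have "xbar \<in> lower_limit D (face ?M) pbar"
    using liminf[of "{}"] independent_K by simp
  then obtain c r0 where c: "c > 0" and r0: "r0 > 0"
    and eb: "\<forall>\<^sub>F p in near. \<forall>x\<in>ball xbar r0. close_to_face c ?M p x"
    using error_bound[OF _ support_active independent_K] by blast
  define \<kappa> where "\<kappa> = Min (insert 1 (lam ` K))"
  have fin: "finite K" using finite_support by simp
  have \<kappa>: "\<kappa> > 0" "\<And>i. i \<in> K \<Longrightarrow> \<kappa> \<le> lam i"
    using fin lam_pos by (auto simp: \<kappa>_def)
  define e where "e = min r0 (\<kappa> / (4 * c))"
  have e: "e > 0" "e \<le> r0" "e * c \<le> \<kappa> / 4"
  proof -
    show "e > 0" "e \<le> r0" using c r0 \<kappa> by (auto simp: e_def)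
    have "e * c \<le> \<kappa> / (4 * c) * c" using c by (intro mult_right_mono) (auto simp: e_def)
    then show "e * c \<le> \<kappa> / 4" using c by simp
  qed
  obtain r1 where r1: "r1 > 0"
    "\<forall>\<^sub>F p in near. feasible p \<noteq> {} \<and> (\<forall>v\<in>ball vbar r1. dist xbar (proj v p) < e)"
    using projection_near[OF e(1)] by blast
  define n where "n p = (\<Sum>i\<in>?M. lam i *\<^sub>R g i p)" for p
  have "(n \<longlongrightarrow> n pbar) near"
    unfolding n_def using support_subset by (intro tendsto_intros tendsto_data) auto
  then have "\<forall>\<^sub>F p in near. dist (n p) (n pbar) < e" using e(1) by (rule tendstoD)
  with eb r1(2) have "\<forall>\<^sub>F p in near. \<forall>v\<in>ball vbar (min r1 e). proj v p \<in> face ?M p"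
  proof eventually_elim
    case (elim p)
    show ?case
    proof
      fix v assume v: "v \<in> ball vbar (min r1 e)"
      define x where "x = proj v p"
      have x: "x \<in> feasible p" "dist xbar x < e"
        unfolding x_def using elim(2) feasible_projection(1) v by auto
      define s where "s = (\<Sum>i\<in>K. f i p - x \<bullet> g i p)"
      have slack: "f i p - x \<bullet> g i p \<ge> 0" if "i \<in> K" for i
        using that x(1) K_active by (auto simp: polyhedral_set_def)
      then have s: "s \<ge> 0" by (simp add: s_def sum_nonneg)
      have "close_to_face c ?M p x" using elim(1) x(2) e(2) by simp
      moreover have "\<forall>i\<in>?M. \<bar>x \<bullet> g i p - f i p\<bar> \<le> s"
      proof
        fix i assume i: "i \<in> ?M"
        show "\<bar>x \<bullet> g i p - f i p\<bar> \<le> s"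
        proof (cases "i \<in> K")
          case True
          then have "f i p - x \<bullet> g i p \<le> s"
            unfolding s_def using slack fin by (intro member_le_sum) auto
          then show ?thesis using slack[OF True] by simp
        next
          case False
          then show ?thesis using i x(1) s by (simp add: polyhedral_set_def)
        qed
      qed
      moreover have "\<forall>i\<in>I\<^sub>2 - ?M. x \<bullet> g i p - f i p \<le> s"
        using x(1) s by (force simp: polyhedral_set_def)
      ultimately obtain y where y: "y \<in> face ?M p" "norm (x - y) \<le> c * s"
        using s unfolding close_to_face_def by blast
      have "\<kappa> * s \<le> n p \<bullet> (y - x)"
      proof -
        have slope: "g i p \<bullet> (y - x) = y \<bullet> g i p - x \<bullet> g i p" for i
          by (metis inner_commute inner_diff_left)
        have "\<kappa> * s \<le> (\<Sum>i\<in>K. lam i * (f i p - x \<bullet> g i p))"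
          unfolding s_def sum_distrib_left using slack \<kappa>(2) by (intro sum_mono mult_right_mono)
        also have "\<dots> = (\<Sum>i\<in>K. lam i * (g i p \<bullet> (y - x)))"
          using y(1) by (intro sum.cong) (auto simp: polyhedral_set_def slope)
        also have "\<dots> = (\<Sum>i\<in>?M. lam i * (g i p \<bullet> (y - x)))"
          using y(1) x(1) finite_support
          by (intro sum.mono_neutral_left) (auto simp: polyhedral_set_def slope)
        finally show ?thesis by (simp add: n_def inner_sum_left)
      qed
      also have "n p \<bullet> (y - x) \<le> (n p - (v - x)) \<bullet> (y - x)"
      proof -
        have "y \<in> feasible p" using y(1) face_subset[of ?M] support_subset by blast
        then have "(v - x) \<bullet> (y - x) \<le> 0"
          unfolding x_def using feasible_projection(2) by blast
        then show ?thesis by (simp add: inner_diff_left)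
      qed
      also have "\<dots> \<le> norm (n p - (v - x)) * norm (y - x)" by (rule norm_cauchy_schwarz)
      also have "\<dots> \<le> (3 * e) * (c * s)"
      proof (rule mult_mono)
        have "n p - (v - x) = (n p - n pbar) + ((vbar - v) - (xbar - x))"
          using representation by (simp add: n_def[symmetric])
        also have "norm \<dots> \<le> norm (n p - n pbar) + (norm (vbar - v) + norm (xbar - x))"
          by (meson add_left_mono norm_triangle_ineq norm_triangle_ineq4 order_trans)
        also have "\<dots> \<le> 3 * e" using elim(3) v x(2) by (simp add: dist_norm)
        finally show "norm (n p - (v - x)) \<le> 3 * e" .
        show "norm (y - x) \<le> c * s" using y(2) by (simp add: norm_minus_commute)
      qed (use e(1) in auto)
      also have "\<dots> \<le> 3 / 4 * \<kappa> * s"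
        using mult_right_mono[OF e(3) s] by (simp add: algebra_simps)
      finally have "\<kappa> * s \<le> 0" by simp
      then have "s = 0" using \<kappa>(1) s by (simp add: mult_le_0_iff)
      then have "\<forall>i\<in>K. f i p - x \<bullet> g i p = 0"
        unfolding s_def using slack fin by (subst (asm) sum_nonneg_eq_0_iff) auto
      then have "x \<in> face ?M p" using x(1) by (auto simp: polyhedral_set_def)
      then show "proj v p \<in> face ?M p" by (simp add: x_def)
    qed
  qed
  then show ?thesis using r1(1) e(1) by (intro exI[of _ "min r1 e"]) auto
qed

text \<open>The set \<open>N\<close> of additional inequalities in a representation of \<open>v - proj v p\<close> depends on \<open>v\<close> and \<open>p\<close>,
  so the error bound is needed with constants common to all admissible sets.\<close>

lemma error_bound_uniform:
  "\<exists>c>0. \<exists>r>0. \<forall>\<^sub>F p in near. \<forall>x\<in>ball xbar r. \<forall>L. L \<subseteq> (active \<inter> I\<^sub>2) - K \<longrightarrow>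
     independent_family (I\<^sub>1 \<union> K \<union> L) (\<lambda>i. g i pbar) \<longrightarrow> close_to_face c (I\<^sub>1 \<union> K \<union> L) p x"
proof -
  define \<L> where
    "\<L> = {L. L \<subseteq> (active \<inter> I\<^sub>2) - K \<and> independent_family (I\<^sub>1 \<union> K \<union> L) (\<lambda>i. g i pbar)}"
  have "finite ((active \<inter> I\<^sub>2) - K)" using active_subset by (intro finite_indices) blast
  then have "finite \<L>" unfolding \<L>_def by simp
  have "{} \<in> \<L>" using independent_K by (simp add: \<L>_def)
  then have "\<L> \<noteq> {}" by blast
  have "\<exists>c r. c > 0 \<and> r > 0 \<and> (\<forall>\<^sub>F p in near. \<forall>x\<in>ball xbar r. close_to_face c (I\<^sub>1 \<union> K \<union> L) p x)"
    if "L \<in> \<L>" for L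
    using error_bound[of "I\<^sub>1 \<union> K \<union> L"] liminf[of L] that support_active by (auto simp: \<L>_def)
  then obtain c r where cr: "\<And>L. L \<in> \<L> \<Longrightarrow> c L > 0" "\<And>L. L \<in> \<L> \<Longrightarrow> r L > 0"
    "\<And>L. L \<in> \<L> \<Longrightarrow> \<forall>\<^sub>F p in near. \<forall>x\<in>ball xbar (r L). close_to_face (c L) (I\<^sub>1 \<union> K \<union> L) p x"
    by metis
  define c0 where "c0 = Max (c ` \<L>)"
  define r0 where "r0 = Min (r ` \<L>)"
  have c0: "c L \<le> c0" and r0: "r0 \<le> r L" if "L \<in> \<L>" for L
    using that \<open>finite \<L>\<close> by (simp_all add: c0_def r0_def)
  have "c0 > 0" using cr(1) c0 \<open>{} \<in> \<L>\<close> by (meson less_le_trans)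
  moreover have "r0 > 0" using cr(2) \<open>finite \<L>\<close> \<open>\<L> \<noteq> {}\<close> by (simp add: r0_def)
  moreover have "\<forall>\<^sub>F p in near. \<forall>L\<in>\<L>. \<forall>x\<in>ball xbar (r L). close_to_face (c L) (I\<^sub>1 \<union> K \<union> L) p x"
    using cr(3) \<open>finite \<L>\<close> by (intro eventually_ball_finite) auto
  then have "\<forall>\<^sub>F p in near. \<forall>x\<in>ball xbar r0. \<forall>L\<in>\<L>. close_to_face c0 (I\<^sub>1 \<union> K \<union> L) p x"
  proof eventually_elim
    case (elim p)
    show ?case
    proof (intro ballI)
      fix x L assume x: "x \<in> ball xbar r0" and L: "L \<in> \<L>"
      then have "close_to_face (c L) (I\<^sub>1 \<union> K \<union> L) p x" using elim r0[OF L] by auto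
      then show "close_to_face c0 (I\<^sub>1 \<union> K \<union> L) p x" using c0[OF L] by (rule close_to_face_mono)
    qed
  qed
  ultimately show ?thesis
    by (intro exI[of _ c0] exI[of _ r0] conjI) (auto simp: \<L>_def elim: eventually_mono)
qed

text \<open>The comparison of the projections \<open>x1\<close> and \<open>x2\<close> of the same point \<open>v\<close> at two parameters. The point
  \<open>y\<close> lies on the face at \<open>p2\<close> of exactly the constraints whose gradients represent \<open>v - x1\<close>; it
  replaces \<open>x1\<close>, which need not be feasible at \<open>p2\<close>. Testing the two variational
  inequalities with \<open>x1\<close> and \<open>x2\<close> themselves and bounded multipliers gives only a Hoelder estimate
  of exponent one half.\<close>

lemma projection_lipschitz_step:
  assumes c: "c1 > 0" "c2 > 0" and L: "L \<ge> 0"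
    and data: "\<And>i. i \<in> I\<^sub>1 \<union> I\<^sub>2 \<Longrightarrow> \<bar>f i p1 - f i p2\<bar> \<le> L * dist p1 p2"
      "\<And>i. i \<in> I\<^sub>1 \<union> I\<^sub>2 \<Longrightarrow> norm (g i p1 - g i p2) \<le> L * dist p1 p2"
    and x1: "x1 \<in> face (I\<^sub>1 \<union> K) p1"
    and mult: "bounded_multipliers c1 (I\<^sub>1 \<union> K) p1 x1 (v - x1)"
    and x2: "x2 \<in> face (I\<^sub>1 \<union> K) p2"
    and normal2: "\<And>y. y \<in> feasible p2 \<Longrightarrow> (v - x2) \<bullet> (y - x2) \<le> 0"
    and near_face: "\<And>N. N \<subseteq> (active \<inter> I\<^sub>2) - K \<Longrightarrow>
      independent_family (I\<^sub>1 \<union> K \<union> N) (\<lambda>i. g i pbar) \<Longrightarrow> close_to_face c2 (I\<^sub>1 \<union> K \<union> N) p2 x1"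
  shows "norm (x1 - x2) \<le> (norm (v - x1) / c1 + c2 * (norm x1 + 1)) * L * dist p1 p2"
proof -
  let ?M = "I\<^sub>1 \<union> K" and ?\<delta> = "L * dist p1 p2"
  have \<delta>: "?\<delta> \<ge> 0" using L by simp
  obtain N \<mu> where N: "N \<subseteq> I\<^sub>2 - ?M" "N \<subseteq> active" "\<forall>i\<in>N. x1 \<bullet> g i p1 = f i p1"
    "independent_family (?M \<union> N) (\<lambda>i. g i pbar)"
    "v - x1 = (\<Sum>i\<in>?M \<union> N. \<mu> i *\<^sub>R g i p1)" "\<forall>i\<in>N. \<mu> i \<ge> 0"
    "c1 * (\<Sum>i\<in>?M \<union> N. \<bar>\<mu> i\<bar>) \<le> norm (v - x1)"
    using mult unfolding bounded_multipliers_def by blast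
  have MN: "?M \<union> N \<subseteq> I\<^sub>1 \<union> I\<^sub>2" using N(1) support_subset by blast
  have close: "close_to_face c2 (?M \<union> N) p2 x1" using N(1,2,4) by (intro near_face) auto
  have shift: "\<bar>(x1 \<bullet> g i p2 - f i p2) - (x1 \<bullet> g i p1 - f i p1)\<bar> \<le> (norm x1 + 1) * ?\<delta>"
    if i: "i \<in> I\<^sub>1 \<union> I\<^sub>2" for i
  proof -
    have "(x1 \<bullet> g i p2 - f i p2) - (x1 \<bullet> g i p1 - f i p1) = (f i p1 - f i p2) - x1 \<bullet> (g i p1 - g i p2)"
      by (simp add: inner_diff_right)
    also have "\<bar>\<dots>\<bar> \<le> \<bar>f i p1 - f i p2\<bar> + \<bar>x1 \<bullet> (g i p1 - g i p2)\<bar>" by (rule abs_triangle_ineq4)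
    also have "\<bar>x1 \<bullet> (g i p1 - g i p2)\<bar> \<le> norm x1 * norm (g i p1 - g i p2)"
      by (rule Cauchy_Schwarz_ineq2)
    also have "\<dots> \<le> norm x1 * ?\<delta>" using data(2)[OF i] by (intro mult_left_mono) auto
    finally show ?thesis using data(1)[OF i] by (simp add: algebra_simps)
  qed
  have act: "x1 \<bullet> g i p1 = f i p1" if "i \<in> ?M \<union> N" for i
    using that x1 N(3) by (auto simp: polyhedral_set_def)
  have "\<forall>i\<in>?M \<union> N. \<bar>x1 \<bullet> g i p2 - f i p2\<bar> \<le> (norm x1 + 1) * ?\<delta>"
    using shift act MN by fastforce
  moreover have "\<forall>i\<in>I\<^sub>2 - (?M \<union> N). x1 \<bullet> g i p2 - f i p2 \<le> (norm x1 + 1) * ?\<delta>"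
  proof
    fix i assume i: "i \<in> I\<^sub>2 - (?M \<union> N)"
    then have "x1 \<bullet> g i p1 - f i p1 \<le> 0" using x1 by (auto simp: polyhedral_set_def)
    then show "x1 \<bullet> g i p2 - f i p2 \<le> (norm x1 + 1) * ?\<delta>" using shift[of i] i by auto
  qed
  moreover have "(norm x1 + 1) * ?\<delta> \<ge> 0" using \<delta> by simp
  ultimately obtain y where y: "y \<in> face (?M \<union> N) p2" "norm (x1 - y) \<le> c2 * ((norm x1 + 1) * ?\<delta>)"
    using close unfolding close_to_face_def by blast
  define n where "n = (\<Sum>i\<in>?M \<union> N. \<mu> i *\<^sub>R g i p2)"
  \<comment> \<open>On \<open>I\<^sub>1 \<union> K\<close> the product vanishes whatever the sign of the multiplier: both \<open>y\<close> and \<open>x2\<close>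
    satisfy these constraints with equality.\<close>
  have "0 \<le> \<mu> i * (g i p2 \<bullet> (y - x2))" if i: "i \<in> ?M \<union> N" for i
  proof -
    have "y \<bullet> g i p2 = f i p2" using y(1) i by (auto simp: polyhedral_set_def)
    then have slope: "g i p2 \<bullet> (y - x2) = f i p2 - x2 \<bullet> g i p2"
      by (metis inner_commute inner_diff_left)
    show ?thesis
    proof (cases "i \<in> ?M")
      case True
      then have "x2 \<bullet> g i p2 = f i p2" using x2 by (auto simp: polyhedral_set_def)
      then show ?thesis by (simp add: slope)
    next
      case False
      then have "i \<in> N" using i by blast
      then have "x2 \<bullet> g i p2 \<le> f i p2" "\<mu> i \<ge> 0" using x2 N(1,6) by (auto simp: polyhedral_set_def)
      then show ?thesis by (simp add: slope)
    qed
  qed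
  then have "n \<bullet> (y - x2) \<ge> 0"
    unfolding n_def inner_sum_left inner_scaleR_left by (intro sum_nonneg)
  moreover have "(v - x2) \<bullet> (y - x2) \<le> 0"
    using normal2 y(1) face_subset[of "?M \<union> N"] MN by blast
  moreover have "(x1 - x2) + (v - x1 - n) = (v - x2) - n" "(x1 - x2) + (y - x1) = y - x2"
    by simp_all
  ultimately have "((x1 - x2) + (v - x1 - n)) \<bullet> ((x1 - x2) + (y - x1)) \<le> 0"
    by (simp only: inner_diff_left)
  then have "norm (x1 - x2) \<le> norm (v - x1 - n) + norm (y - x1)"
    by (rule norm_le_if_inner_shifted_nonpos)
  also have "norm (v - x1 - n) \<le> norm (v - x1) / c1 * ?\<delta>"
  proof -
    have "v - x1 - n = (\<Sum>i\<in>?M \<union> N. \<mu> i *\<^sub>R (g i p1 - g i p2))"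
      by (simp add: N(5) n_def scaleR_diff_right sum_subtractf)
    also have "norm \<dots> \<le> (\<Sum>i\<in>?M \<union> N. \<bar>\<mu> i\<bar> * ?\<delta>)"
      using data(2) MN by (intro sum_norm_le) (auto intro!: mult_left_mono)
    also have "\<dots> = (\<Sum>i\<in>?M \<union> N. \<bar>\<mu> i\<bar>) * ?\<delta>" by (simp add: sum_distrib_right)
    also have "\<dots> \<le> norm (v - x1) / c1 * ?\<delta>"
      using N(7) c(1) \<delta> by (intro mult_right_mono) (auto simp: field_simps)
    finally show ?thesis .
  qed
  also have "norm (y - x1) \<le> c2 * ((norm x1 + 1) * ?\<delta>)" using y(2) by (simp add: norm_minus_commute)
  finally show ?thesis by (simp add: algebra_simps)
qed

lemma projection_lipschitz:
  "\<exists>r>0. \<exists>l>0. \<exists>T. (\<forall>\<^sub>F p in near. p \<in> T) \<and> (\<forall>p\<in>T. feasible p \<noteq> {}) \<and>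
     (\<forall>v\<in>ball vbar r. \<forall>p1\<in>T. \<forall>p2\<in>T. norm (proj v p1 - proj v p2) \<le> l * dist p1 p2)"
proof -
  let ?M = "I\<^sub>1 \<union> K"
  obtain c1 r1 where c1: "c1 > 0" and r1: "r1 > 0" and mult: "\<forall>\<^sub>F p in near. \<forall>y\<in>face ?M p.
      dist xbar y < r1 \<longrightarrow>
      (\<forall>w. (\<forall>z\<in>face ?M p. w \<bullet> (z - y) \<le> 0) \<longrightarrow> bounded_multipliers c1 ?M p y w)"
    using multipliers[OF _ support_active independent_K] by blast
  obtain c2 r2 where c2: "c2 > 0" and r2: "r2 > 0" and
    eb: "\<forall>\<^sub>F p in near. \<forall>x\<in>ball xbar r2. \<forall>N. N \<subseteq> (active \<inter> I\<^sub>2) - K \<longrightarrow>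
      independent_family (?M \<union> N) (\<lambda>i. g i pbar) \<longrightarrow> close_to_face c2 (?M \<union> N) p x"
    using error_bound_uniform by blast
  obtain r3 where r3: "r3 > 0" and on_face: "\<forall>\<^sub>F p in near. \<forall>v\<in>ball vbar r3. proj v p \<in> face ?M p"
    using projection_on_face by blast
  define e where "e = min 1 (min r1 r2)"
  have e: "e > 0" "e \<le> 1" "e \<le> r1" "e \<le> r2" using r1 r2 by (auto simp: e_def)
  obtain r4 where r4: "r4 > 0" and cont: "\<forall>\<^sub>F p in near. feasible p \<noteq> {} \<and>
      (\<forall>v\<in>ball vbar r4. dist xbar (proj v p) < e)"
    using projection_near[OF e(1)] by blast
  obtain u L where u: "u > 0" and L: "L > 0"
    "\<forall>i\<in>I\<^sub>1 \<union> I\<^sub>2. L-lipschitz_on (cball pbar u \<inter> D) (f i)"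
    using locally_lipschitz_family[OF finite_index pbar_in] lipschitz_f by metis
  obtain u' L' where u': "u' > 0" and L': "L' > 0"
    "\<forall>i\<in>I\<^sub>1 \<union> I\<^sub>2. L'-lipschitz_on (cball pbar u' \<inter> D) (g i)"
    using locally_lipschitz_family[OF finite_index pbar_in] lipschitz_g by metis
  have lip: "\<forall>\<^sub>F p in near. p \<in> D \<and> dist pbar p \<le> min u u'"
    unfolding eventually_inf_principal eventually_nhds_metric
    using u u' by (intro exI[of _ "min u u'"]) (auto simp: dist_commute)
  \<comment> \<open>Each condition concerns a single parameter, so that any two points of \<open>T\<close> can be compared.\<close>
  define T where "T = {p. (\<forall>y\<in>face ?M p. dist xbar y < r1 \<longrightarrow>
      (\<forall>w. (\<forall>z\<in>face ?M p. w \<bullet> (z - y) \<le> 0) \<longrightarrow> bounded_multipliers c1 ?M p y w)) \<and>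
    (\<forall>x\<in>ball xbar r2. \<forall>N. N \<subseteq> (active \<inter> I\<^sub>2) - K \<longrightarrow>
      independent_family (?M \<union> N) (\<lambda>i. g i pbar) \<longrightarrow> close_to_face c2 (?M \<union> N) p x) \<and>
    (\<forall>v\<in>ball vbar r3. proj v p \<in> face ?M p) \<and>
    feasible p \<noteq> {} \<and> (\<forall>v\<in>ball vbar r4. dist xbar (proj v p) < e) \<and>
    p \<in> D \<and> dist pbar p \<le> min u u'}"
  have ev: "\<forall>\<^sub>F p in near. p \<in> T"
    using mult eb on_face cont lip by eventually_elim (simp add: T_def)
  define l where "l = ((norm vbar + norm xbar + 2) / c1 + c2 * (norm xbar + 2)) * max L L'"
  have "c2 * (norm xbar + 2) > 0" using c2 by (simp add: add_nonneg_pos)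
  moreover have "(norm vbar + norm xbar + 2) / c1 \<ge> 0" using c1 by simp
  ultimately have l: "l > 0"
    unfolding l_def using L(1) by (intro mult_pos_pos[OF add_nonneg_pos]) auto
  define r where "r = min 1 (min r3 r4)"
  have r: "r > 0" "r \<le> 1" "r \<le> r3" "r \<le> r4" using r3 r4 by (auto simp: r_def)
  have "norm (proj v p1 - proj v p2) \<le> l * dist p1 p2"
    if v: "v \<in> ball vbar r" and p: "p1 \<in> T" "p2 \<in> T" for v p1 p2
  proof -
    define x1 where "x1 = proj v p1"
    define x2 where "x2 = proj v p2"
    have v34: "v \<in> ball vbar r3" "v \<in> ball vbar r4" using v r(3,4) by auto
    have ne: "feasible p1 \<noteq> {}" "feasible p2 \<noteq> {}" using p by (auto simp: T_def)
    have x1: "x1 \<in> face ?M p1" "dist xbar x1 < e" and x2: "x2 \<in> face ?M p2"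
      using p v34 by (auto simp: T_def x1_def x2_def)
    have norm_x1: "norm x1 \<le> norm xbar + 1"
      using norm_triangle_sub[of x1 xbar] x1(2) e(2) by (simp add: dist_norm norm_minus_commute)
    have "norm v \<le> norm vbar + 1"
      using norm_triangle_sub[of v vbar] v r(2) by (simp add: dist_norm norm_minus_commute)
    then have norm_vx: "norm (v - x1) \<le> norm vbar + norm xbar + 2"
      using norm_triangle_ineq4[of v x1] norm_x1 by linarith
    have "norm (x1 - x2) \<le>
        (norm (v - x1) / c1 + c2 * (norm x1 + 1)) * max L L' * dist p1 p2"
    proof (rule projection_lipschitz_step)
      have mem: "p1 \<in> cball pbar u \<inter> D" "p2 \<in> cball pbar u \<inter> D"
        "p1 \<in> cball pbar u' \<inter> D" "p2 \<in> cball pbar u' \<inter> D"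
        using p by (auto simp: T_def)
      fix i assume i: "i \<in> I\<^sub>1 \<union> I\<^sub>2"
      have "dist (f i p1) (f i p2) \<le> L * dist p1 p2"
        using L(2) i mem by (intro lipschitz_onD[of L "cball pbar u \<inter> D"]) auto
      also have "\<dots> \<le> max L L' * dist p1 p2" by (intro mult_right_mono) auto
      finally show "\<bar>f i p1 - f i p2\<bar> \<le> max L L' * dist p1 p2" by (simp add: dist_real_def)
      have "dist (g i p1) (g i p2) \<le> L' * dist p1 p2"
        using L'(2) i mem by (intro lipschitz_onD[of L' "cball pbar u' \<inter> D"]) auto
      also have "\<dots> \<le> max L L' * dist p1 p2" by (intro mult_right_mono) auto
      finally show "norm (g i p1 - g i p2) \<le> max L L' * dist p1 p2" by (simp add: dist_norm)
    next
      have "face ?M p1 \<subseteq> feasible p1" using face_subset[of ?M] support_subset by blast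
      then have "\<forall>z\<in>face ?M p1. (v - x1) \<bullet> (z - x1) \<le> 0"
        unfolding x1_def using feasible_projection(2)[OF ne(1)] by blast
      then show "bounded_multipliers c1 ?M p1 x1 (v - x1)"
        using p(1) x1 e(3) by (simp add: T_def)
    next
      fix N assume "N \<subseteq> (active \<inter> I\<^sub>2) - K" "independent_family (?M \<union> N) (\<lambda>i. g i pbar)"
      moreover have "x1 \<in> ball xbar r2" using x1(2) e(4) by simp
      ultimately show "close_to_face c2 (?M \<union> N) p2 x1" using p(2) unfolding T_def by blast
    next
      show "(v - x2) \<bullet> (y - x2) \<le> 0" if "y \<in> feasible p2" for y
        unfolding x2_def using feasible_projection(2)[OF ne(2) that] .
    qed (use c1 c2 L(1) x1(1) x2 in auto)
    also have "\<dots> \<le> l * dist p1 p2"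
    proof -
      have "norm (v - x1) / c1 \<le> (norm vbar + norm xbar + 2) / c1"
        using norm_vx c1 by (intro divide_right_mono) auto
      moreover have "c2 * (norm x1 + 1) \<le> c2 * (norm xbar + 2)"
        using norm_x1 c2 by (intro mult_left_mono) auto
      ultimately show ?thesis
        unfolding l_def using L(1) by (intro mult_right_mono add_mono) auto
    qed
    finally show ?thesis by (simp add: x1_def x2_def)
  qed
  moreover have "\<forall>p\<in>T. feasible p \<noteq> {}" by (simp add: T_def)
  ultimately show ?thesis
    using ev r(1) l by (intro exI[of _ r] exI[of _ l] exI[of _ T] conjI) blast+
qed

end

section \<open>The reflected projection\<close>

theorem theorem6p4:
  fixes D :: "'g::real_normed_vector set"
    and C :: "'g \<Rightarrow> 'h::{real_inner,complete_space} set"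
    and I\<^sub>1 I\<^sub>2 :: "nat set" and q m :: nat
    and f :: "nat \<Rightarrow> 'g \<Rightarrow> real" and g :: "nat \<Rightarrow> 'g \<Rightarrow> 'h"
    and pbar :: 'g and vbar xbar :: 'h
  assumes "D \<noteq> {}"
    and "I\<^sub>1 = {} \<or> I\<^sub>1 = {1..q}"
    and "I\<^sub>2 = {} \<or> I\<^sub>2 = {q+1..m}"
    and "I\<^sub>1 \<union> I\<^sub>2 \<noteq> {}"
    and "\<forall>i \<in> I\<^sub>1 \<union> I\<^sub>2. locally_lipschitz_on D (f i) \<and> locally_lipschitz_on D (g i)"
    and "\<forall>p\<in>D. C p = polyhedral_set I\<^sub>1 I\<^sub>2 f g p"
    and "pbar \<in> D"
    and "vbar \<notin> C pbar"
    and "C pbar \<noteq> {}" and "xbar = metric_projection (C pbar) vbar"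
    and "\<exists>(J\<^sub>1 :: 'i set) J\<^sub>2 f' g' K.
           equivalent_representation D C J\<^sub>1 J\<^sub>2 f' g' \<and>
           RCRCQ D J\<^sub>1 J\<^sub>2 f' g' pbar xbar \<and>
           stable_representation D C J\<^sub>1 J\<^sub>2 f' g' pbar vbar xbar K"
  shows "\<exists>W U l0. open W \<and> vbar \<in> W \<and> openin (top_of_set D) U \<and> pbar \<in> U \<and> l0 > 0 \<and>
           (\<forall>v\<^sub>1\<in>W. \<forall>p\<^sub>1\<in>U. \<forall>v\<^sub>2\<in>W. \<forall>p\<^sub>2\<in>U.
              C p\<^sub>1 \<noteq> {} \<and> C p\<^sub>2 \<noteq> {} \<and>
              norm ((v\<^sub>1 - v\<^sub>2) -
                2 *\<^sub>R (metric_projection (C p\<^sub>1) v\<^sub>1 - metric_projection (C p\<^sub>2) v\<^sub>2))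
              \<le> norm (v\<^sub>1 - v\<^sub>2) + l0 * norm (p\<^sub>1 - p\<^sub>2))"
proof -
  obtain J\<^sub>1 J\<^sub>2 :: "'i set" and f' g' K where
    equiv: "equivalent_representation D C J\<^sub>1 J\<^sub>2 f' g'" and
    rcrcq: "RCRCQ D J\<^sub>1 J\<^sub>2 f' g' pbar xbar" and
    stable: "stable_representation D C J\<^sub>1 J\<^sub>2 f' g' pbar vbar xbar K"
    using assms(11) by (elim exE conjE) (rule that)
  obtain lam where lam: "vbar - xbar = (\<Sum>i\<in>J\<^sub>1 \<union> K. lam i *\<^sub>R g' i pbar)" "\<forall>i\<in>K. lam i > 0"
    using stable unfolding stable_representation_def by blast
  have C: "C p = polyhedral_set J\<^sub>1 J\<^sub>2 f' g' p" if "p \<in> D" for p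
    using equiv that by (simp add: equivalent_representation_def)
  have disj: "J\<^sub>1 \<inter> J\<^sub>2 = {}" using equiv by (simp add: equivalent_representation_def)
  have closed: "closed (C p)" and convex: "convex (C p)" if "p \<in> D" for p
    using C[OF that] by (simp_all add: closed_polyhedral_set convex_polyhedral_set)
  have "xbar \<in> C pbar"
    unfolding assms(10) by (intro metric_projection_mem closed convex assms(7,9))
  then have xbar_in: "xbar \<in> polyhedral_set J\<^sub>1 J\<^sub>2 f' g' pbar" using C[OF assms(7)] by simp
  interpret stable_system D J\<^sub>1 J\<^sub>2 f' g' pbar xbar vbar K lam
  proof unfold_locales
    fix L assume L: "L \<subseteq> active_set J\<^sub>1 J\<^sub>2 f' g' pbar xbar \<inter> J\<^sub>2 - K"
      "independent_family (J\<^sub>1 \<union> K \<union> L) (\<lambda>i. g' i pbar)"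
    have "J\<^sub>2 - (J\<^sub>1 \<union> K \<union> L) = J\<^sub>2 - (K \<union> L)" using disj by blast
    then show "xbar \<in> lower_limit D
        (polyhedral_set (J\<^sub>1 \<union> K \<union> L) (J\<^sub>2 - (J\<^sub>1 \<union> K \<union> L)) f' g') pbar"
      using stable L unfolding stable_representation_def by simp
  qed (use assms(7) disj equiv rcrcq xbar_in stable lam in
      \<open>auto simp: equivalent_representation_def stable_representation_def\<close>)
  obtain r l T where r: "r > 0" and l: "l > 0" and T: "\<forall>\<^sub>F p in near. p \<in> T"
    and nonempty: "\<forall>p\<in>T. feasible p \<noteq> {}"
    and lip: "\<forall>v\<in>ball vbar r. \<forall>p1\<in>T. \<forall>p2\<in>T. norm (proj v p1 - proj v p2) \<le> l * dist p1 p2"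
    using projection_lipschitz by (elim exE conjE) (rule that)
  obtain U where U: "openin (top_of_set D) U" "pbar \<in> U" "\<forall>p\<in>U. p \<in> D \<and> p \<in> T"
    using eventually_imp_openin[OF T assms(7)] by blast
  have "norm ((v\<^sub>1 - v\<^sub>2) - 2 *\<^sub>R (metric_projection (C p\<^sub>1) v\<^sub>1 - metric_projection (C p\<^sub>2) v\<^sub>2))
      \<le> norm (v\<^sub>1 - v\<^sub>2) + 2 * l * norm (p\<^sub>1 - p\<^sub>2)"
    if v: "v\<^sub>2 \<in> ball vbar r" and p: "p\<^sub>1 \<in> U" "p\<^sub>2 \<in> U" for v\<^sub>1 v\<^sub>2 p\<^sub>1 p\<^sub>2
  proof -
    have CU: "C p\<^sub>1 = feasible p\<^sub>1" "C p\<^sub>2 = feasible p\<^sub>2" using C p U(3) by auto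
    have "(v\<^sub>1 - v\<^sub>2) - 2 *\<^sub>R (proj v\<^sub>1 p\<^sub>1 - proj v\<^sub>2 p\<^sub>2) =
        ((v\<^sub>1 - v\<^sub>2) - 2 *\<^sub>R (proj v\<^sub>1 p\<^sub>1 - proj v\<^sub>2 p\<^sub>1)) - 2 *\<^sub>R (proj v\<^sub>2 p\<^sub>1 - proj v\<^sub>2 p\<^sub>2)"
      by (simp add: algebra_simps)
    also have "norm \<dots> \<le> norm ((v\<^sub>1 - v\<^sub>2) - 2 *\<^sub>R (proj v\<^sub>1 p\<^sub>1 - proj v\<^sub>2 p\<^sub>1)) +
        norm (2 *\<^sub>R (proj v\<^sub>2 p\<^sub>1 - proj v\<^sub>2 p\<^sub>2))"
      by (rule norm_triangle_ineq4)
    also have "\<dots> \<le> norm (v\<^sub>1 - v\<^sub>2) + 2 * (l * dist p\<^sub>1 p\<^sub>2)"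
    proof (rule add_mono)
      show "norm ((v\<^sub>1 - v\<^sub>2) - 2 *\<^sub>R (proj v\<^sub>1 p\<^sub>1 - proj v\<^sub>2 p\<^sub>1)) \<le> norm (v\<^sub>1 - v\<^sub>2)"
        using nonempty p U(3) closed_polyhedral_set convex_polyhedral_set
        by (intro reflected_projection_nonexpansive) auto
      have "norm (proj v\<^sub>2 p\<^sub>1 - proj v\<^sub>2 p\<^sub>2) \<le> l * dist p\<^sub>1 p\<^sub>2" using lip v p U(3) by simp
      then show "norm (2 *\<^sub>R (proj v\<^sub>2 p\<^sub>1 - proj v\<^sub>2 p\<^sub>2)) \<le> 2 * (l * dist p\<^sub>1 p\<^sub>2)" by simp
    qed
    finally show ?thesis by (simp add: CU dist_norm)
  qed
  moreover have "C p \<noteq> {}" if "p \<in> U" for p using that nonempty U(3) C[of p] by auto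
  ultimately show ?thesis
    using r l U(1,2) by (intro exI[of _ "ball vbar r"] exI[of _ U] exI[of _ "2 * l"]) auto
qed

end
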